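(* Let $\mu$ be the Patterson–Sullivan measure for $F$. Then $\mu$-a.e. limit point $\xi\in\Lambda F$ is $\Gamma$-sublinearly conical, i.e. $\mu$-a.e. $\xi\in\Lambda F$ belongs to $\Lambda_{sublinear}\Gamma$.
   Context: $\Gamma=\{\mathfrak{g}_1,\mathfrak{g}_2,\ldots\}$ (a fixed enumeration) is a non-elementary, non-convex-cocompact discrete group acting properly by isometries on $\mathbb{H}^d\ni x_0$ (non-elementary: limit set has more than two points; convex-cocompact: for some $K'>0$ all geodesics $[gx_0,hx_0]$, $g,h\in\Gamma$, lie in the $K'$-neighborhood of $\Gamma x_0$). $\|g\|:=d(x_0,gx_0)$; $B_r:=\{g\in\Gamma:\|g\|<r\}$; $(x|y)_z=\frac12[d(x,z)+d(z,y)-d(x,y)]$; $\mathcal{P}_A(s)=\sum_{g\in A}e^{-s\|g\|}$ with abscissa of convergence $\delta_A$. $\mathcal{O}_{M,M}$ is the set of $g\in\Gamma$ for which there are $x,y\in\mathbb{H}^d$ with $d(x,x_0),d(y,gx_0)\le M$ and $d([x,y],\Gamma x_0)\ge M$. Fixed $a,b\in\Gamma$ satisfy $\|a^n\|,\|b^n\|\to+\infty$ as $n\to+\infty$ and $\|a\|\ge10^3\|b\|>10^6(3+\sup_{n,m\in\mathbb{Z}}(a^nx_0|b^mx_0)_{x_0})$, the supremum being finite. Put $C:=10^{-3}\|a\|$. An element $h\in\Gamma$ has Property (A) if there are $n\ge1$ and points $x_0=z_0,\ldots,z_n=hx_0$ such that in the sequence $(a^{-1}x_0,z_0,\ldots,z_n,hax_0)$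 consecutive points are at distance $\ge\|a\|$ and any three consecutive points $u,v,w$ satisfy $(u|w)_v\le10^{-6}\|a\|$. $\Phi:\Gamma\to\{g: g\text{ has Property (A)}\}$ is a fixed map with $\Phi(g)=g$ if $g$ has Property (A); otherwise $\Phi(g)$ is one of $bg,gb,bgb$ having Property (A) if $\|g\|\ge\|a\|$ (one of them always does), and $\Phi(g)=bab$ if $\|g\|<\|a\|$. Construction of $F$. For $S\subseteq\Gamma$ let $\langle S\rangle_a:=\{g_1ag_2a\cdots ag_n:n\ge1,g_i\in S\}$. Fix $0<\epsilon<1$. Take $r_0$ with $\#B_r\le\exp((1+0.001\epsilon)\delta_\Gamma r)$ for $r\ge r_0$, and $R_0>\frac{10^7(C+r_0)(1+\delta_\Gamma)}{\delta_\Gamma\epsilon}$ with $\#(B_{R_0}\cap\Phi(\Gamma))\ge\exp((1-0.001\epsilon)\delta_\Gamma R_0)$. Let $K$ be a maximal subset of $(B_{R_0}\cap\Phi(\Gamma))\setminus B_{(1-0.003\epsilon)R_0}$ such that $d(gx_0,hx_0)>0.004\epsilon R_0$ for distinct $g,h\in K$. Let $F_1=\langle K\rangle_a$, $\alpha_1=\delta_{F_1}$, and pick $\beta_1\in(\alpha_1,\alpha_1+0.5)$ with $\mathcal{P}_{F_1}(\beta_1)>2$. Inductively, for $k\ge1$, given $\varphi_1,\ldots,\varphi_{k-1}$, $F_k=\langle K\cup\{\varphi_1,\ldots,\varphi_{k-1}\}\rangle_a$ and $\beta_1>\cdots>\beta_k$, put $M_j=\mathcal{P}_{F_k}(\beta_j)$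 and pick, for each $j\le k$, $\epsilon_j\in(0,1/2)$ with $2\epsilon_jM_j<1$ and $\frac{M_j+2\epsilon_j+4M_j\epsilon_j}{1-2\epsilon_jM_j}<(2-2^{j-k-1})\mathcal{P}_{F_j}(\beta_j)$; pick $R_k>100R_{k-1}$ with $K\cup\{\varphi_1,\ldots,\varphi_{k-1}\}\subseteq B_{R_k-10^4C}$ and $e^{-\beta_jR_k}\le\epsilon_j$ for all $j\le k$; pick $\phi_k\in\mathcal{O}_{10C,10C}\setminus B_{R_k+2500C}$; set $\varphi_k:=\Phi(\phi_k)\,a\,\Phi(\mathfrak{g}_k)$, $F_{k+1}:=\langle K\cup\{\varphi_1,\ldots,\varphi_k\}\rangle_a$, $\alpha_{k+1}:=\delta_{F_{k+1}}$, and pick $\beta_{k+1}\in(\alpha_{k+1},\min(\alpha_{k+1}+2^{-k-1},\beta_k))$ with $\mathcal{P}_{F_{k+1}}(\beta_{k+1})>2^{k+1}$. Finally $F:=\bigcup_kF_k=\langle K\cup\{\varphi_1,\varphi_2,\ldots\}\rangle_a$; one has $\mathcal{P}_F(\delta_F)=+\infty$. Patterson–Sullivan measure. For $s>\delta_F$ let $\mu_{x_0}^s=\frac{1}{\mathcal{P}_F(s)}\sum_{g\in F}e^{-s\|g\|}\mathrm{Dir}_{gx_0}$ ($\mathrm{Dir}$ = Dirac mass), a probability measure on the compact set $\Gamma x_0\cup\partial\mathbb{H}^d$. Choose $s_n\searrow\delta_F$ such that $\mu_{x_0}^{s_n}$ converges weakly; the limit $\mu$ is called the Patterson–Sullivan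 measure for $F$. $\Lambda F\subseteq\partial\mathbb{H}^d$ is the set of accumulation points of $Fx_0$ in $\partial\mathbb{H}^d$. For $\xi\in\partial\mathbb{H}^d$ with arc-length parametrized ray $\gamma=[x_0,\xi)$ put $f_\xi(t)=d(\gamma(t),\Gamma x_0)$. Then $\Lambda_c\Gamma=\{\xi:\liminf_{t\to+\infty}f_\xi(t)<+\infty\}$ and $\Lambda_{sublinear}\Gamma=\{\xi\in\Lambda_c\Gamma:\lim_{t\to+\infty}f_\xi(t)/t=0\}$. *)

theory Defs
  imports "HOL-Probability.Probability" "HOL-Algebra.Group_Action"
begin

section \<open>Hyperbolic space and its boundary at infinity\<close>

text \<open>We use the Poincare ball model: hyperbolic d-space is the open unit ball of a Euclidean
  space of dimension d with the metric \<open>hdist\<close>, its boundary at infinity is the unit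
  sphere, and the topology of the compactification is the Euclidean one on the closed ball.\<close>

definition hyp :: "'a::euclidean_space set" where
  "hyp = ball 0 1"

definition hyp_boundary :: "'a::euclidean_space set" where
  "hyp_boundary = sphere 0 1"

definition hdist :: "'a::euclidean_space \<Rightarrow> 'a \<Rightarrow> real" where
  "hdist x y = arcosh (1 + 2 * (norm (x - y))\<^sup>2 / ((1 - (norm x)\<^sup>2) * (1 - (norm y)\<^sup>2)))"

definition hset_dist :: "'a::euclidean_space set \<Rightarrow> 'a set \<Rightarrow> real" where
  "hset_dist A B = (INF p\<in>A \<times> B. hdist (fst p) (snd p))"

definition gromov_prod :: "'a::euclidean_space \<Rightarrow> 'a \<Rightarrow> 'a \<Rightarrow> real" where
  "gromov_prod z x y = (hdist x z + hdist z y - hdist x y) / 2"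
    \<comment> \<open>the product of \<open>x\<close> and \<open>y\<close> based at the first argument \<open>z\<close>\<close>

definition hgeodesic_on :: "real set \<Rightarrow> (real \<Rightarrow> 'a::euclidean_space) \<Rightarrow> bool" where
  "hgeodesic_on I \<gamma> \<longleftrightarrow> \<gamma> ` I \<subseteq> hyp \<and> (\<forall>s\<in>I. \<forall>t\<in>I. hdist (\<gamma> s) (\<gamma> t) = \<bar>s - t\<bar>)"

definition hsegment :: "'a::euclidean_space \<Rightarrow> 'a \<Rightarrow> 'a set" where
  "hsegment x y = \<Union> {\<gamma> ` {0..hdist x y} | \<gamma>.
     hgeodesic_on {0..hdist x y} \<gamma> \<and> \<gamma> 0 = x \<and> \<gamma> (hdist x y) = y}"
    \<comment> \<open>hyperbolic space is uniquely geodesic, so this is a union over one set\<close>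

definition hray :: "'a::euclidean_space \<Rightarrow> 'a \<Rightarrow> (real \<Rightarrow> 'a) \<Rightarrow> bool" where
  "hray x \<xi> \<gamma> \<longleftrightarrow> hgeodesic_on {0..} \<gamma> \<and> \<gamma> 0 = x \<and> (\<gamma> \<longlongrightarrow> \<xi>) at_top"
    \<comment> \<open>for given \<open>x\<close> and \<open>\<xi>\<close> the ray is unique on \<open>{0..}\<close>\<close>


section \<open>Weak convergence of measures on a subspace\<close>

definition weakly_converges_on ::
    "'a::topological_space set \<Rightarrow> (nat \<Rightarrow> 'a measure) \<Rightarrow> 'a measure \<Rightarrow> bool" where
  "weakly_converges_on X \<nu> \<mu> \<longleftrightarrow>
     (\<forall>f::'a \<Rightarrow> real. continuous_on X f \<longrightarrow> bounded (f ` X) \<longrightarrow>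
        (\<lambda>n. \<integral>x. f x \<partial>\<nu> n) \<longlonglongrightarrow> (\<integral>x. f x \<partial>\<mu>))"


section \<open>Groups acting on hyperbolic space\<close>

inductive_set span_via :: "('g, 'm) monoid_scheme \<Rightarrow> 'g \<Rightarrow> 'g set \<Rightarrow> 'g set"
  for \<Gamma> (structure) and a :: 'g and S :: "'g set" where
  single: "g \<in> S \<Longrightarrow> g \<in> span_via \<Gamma> a S"
| snoc: "w \<in> span_via \<Gamma> a S \<Longrightarrow> g \<in> S \<Longrightarrow> w \<otimes> a \<otimes> g \<in> span_via \<Gamma> a S"

locale hyp_orbit =
  fixes \<Gamma> :: "('g, 'm) monoid_scheme" (structure)
    and act :: "'g \<Rightarrow> 'a::euclidean_space \<Rightarrow> 'a"
    and x0 :: 'a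
begin

definition orbit_of :: "'g set \<Rightarrow> 'a set" where
  "orbit_of A = (\<lambda>g. act g x0) ` A"

definition len :: "'g \<Rightarrow> real" where
  "len g = hdist x0 (act g x0)"

definition gball :: "real \<Rightarrow> 'g set" where
  "gball r = {g \<in> carrier \<Gamma>. len g < r}"

definition poincare_series :: "'g set \<Rightarrow> real \<Rightarrow> ennreal" where
  "poincare_series A s = (\<Sum>\<^sub>\<infinity>g\<in>A. ennreal (exp (- s * len g)))"

text \<open>The infimum is taken in the reals. For a discrete group and infinite \<open>A\<close>, the
  only case in which it is used below, the set is nonempty and bounded below by 0.\<close>

definition crit_exp :: "'g set \<Rightarrow> real" where
  "crit_exp A = Inf {s. poincare_series A s < \<infinity>}"

definition limit_set :: "'g set \<Rightarrow> 'a set" where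
  "limit_set A = {\<xi> \<in> hyp_boundary. \<xi> islimpt orbit_of A}"

definition non_elementary :: bool where
  "non_elementary \<longleftrightarrow>
     \<not> (finite (limit_set (carrier \<Gamma>)) \<and> card (limit_set (carrier \<Gamma>)) \<le> 2)"

definition convex_cocompact :: bool where
  "convex_cocompact \<longleftrightarrow>
     (\<exists>K'>0. \<forall>g\<in>carrier \<Gamma>. \<forall>h\<in>carrier \<Gamma>. \<forall>z\<in>hsegment (act g x0) (act h x0).
        hset_dist {z} (orbit_of (carrier \<Gamma>)) < K')"

definition excursions :: "real \<Rightarrow> 'g set" where
  "excursions M = {g \<in> carrier \<Gamma>. \<exists>x\<in>hyp. \<exists>y\<in>hyp.
     hdist x x0 \<le> M \<and> hdist y (act g x0) \<le> M \<and>
     hset_dist (hsegment x y) (orbit_of (carrier \<Gamma>)) \<ge> M}"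
    \<comment> \<open>the set written with the double index \<open>M,M\<close>\<close>

definition conical_limit_set :: "'a set" where
  "conical_limit_set = {\<xi> \<in> hyp_boundary. \<exists>\<gamma>. hray x0 \<xi> \<gamma> \<and>
     Liminf at_top (\<lambda>t. ereal (hset_dist {\<gamma> t} (orbit_of (carrier \<Gamma>)))) < \<infinity>}"

definition sublinear_limit_set :: "'a set" where
  "sublinear_limit_set = {\<xi> \<in> conical_limit_set. \<exists>\<gamma>. hray x0 \<xi> \<gamma> \<and>
     ((\<lambda>t. hset_dist {\<gamma> t} (orbit_of (carrier \<Gamma>)) / t) \<longlongrightarrow> 0) at_top}"

definition property_A :: "'g \<Rightarrow> 'g \<Rightarrow> bool" where
  "property_A a h \<longleftrightarrow> h \<in> carrier \<Gamma> \<and>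
     (\<exists>zs. length zs \<ge> 2 \<and> set zs \<subseteq> hyp \<and> hd zs = x0 \<and> last zs = act h x0 \<and>
        (let ws = act (inv a) x0 # zs @ [act (h \<otimes> a) x0] in
          (\<forall>i. i + 1 < length ws \<longrightarrow> hdist (ws ! i) (ws ! (i + 1)) \<ge> len a) \<and>
          (\<forall>i. i + 2 < length ws \<longrightarrow>
             gromov_prod (ws ! (i + 1)) (ws ! i) (ws ! (i + 2)) \<le> len a / 10 ^ 6)))"

definition power_products :: "'g \<Rightarrow> 'g \<Rightarrow> real set" where
  "power_products a b =
     {gromov_prod x0 (act (a [^] n) x0) (act (b [^] m) x0) | (n::int) (m::int). True}"

definition compactified_orbit :: "'a set" where
  "compactified_orbit = orbit_of (carrier \<Gamma>) \<union> hyp_boundary"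

definition ps_approx :: "'g set \<Rightarrow> real \<Rightarrow> 'a measure" where
  "ps_approx F s =
     distr (point_measure F (\<lambda>g. ennreal (exp (- s * len g)) / poincare_series F s))
       (restrict_space borel compactified_orbit) (\<lambda>g. act g x0)"

definition patterson_sullivan :: "'g set \<Rightarrow> 'a measure \<Rightarrow> bool" where
  "patterson_sullivan F \<mu> \<longleftrightarrow>
     sets \<mu> = sets (restrict_space borel compactified_orbit) \<and> prob_space \<mu> \<and>
     (\<exists>s. decseq s \<and> (\<forall>n. s n > crit_exp F) \<and> s \<longlonglongrightarrow> crit_exp F \<and>
        weakly_converges_on compactified_orbit (\<lambda>n. ps_approx F (s n)) \<mu>)"

end

locale discrete_hyp_group = hyp_orbit \<Gamma> act x0
  for \<Gamma> :: "('g, 'm) monoid_scheme" (structure)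
    and act :: "'g \<Rightarrow> 'a::euclidean_space \<Rightarrow> 'a" and x0 :: 'a +
  assumes x0_in_hyp: "x0 \<in> hyp"
    and action: "group_action \<Gamma> hyp act"
    and isometric: "\<And>g x y. g \<in> carrier \<Gamma> \<Longrightarrow> x \<in> hyp \<Longrightarrow> y \<in> hyp \<Longrightarrow>
          hdist (act g x) (act g y) = hdist x y"
    and proper: "\<And>Q. compact Q \<Longrightarrow> Q \<subseteq> hyp \<Longrightarrow>
          finite {g \<in> carrier \<Gamma>. act g ` Q \<inter> Q \<noteq> {}}"
    and non_elementary: non_elementary
    and not_convex_cocompact: "\<not> convex_cocompact"


section \<open>The elements a, b, the map \<open>\<Phi>\<close> and the enumeration\<close>

locale hyp_group_with_map = discrete_hyp_group \<Gamma> act x0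
  for \<Gamma> :: "('g, 'm) monoid_scheme" (structure)
    and act :: "'g \<Rightarrow> 'a::euclidean_space \<Rightarrow> 'a" and x0 :: 'a +
  fixes enum :: "nat \<Rightarrow> 'g" \<comment> \<open>used at indices at least 1 only\<close>
    and a b :: 'g
    and \<Phi> :: "'g \<Rightarrow> 'g"
  assumes enum: "enum ` {1..} = carrier \<Gamma>"
    and a_in: "a \<in> carrier \<Gamma>" and b_in: "b \<in> carrier \<Gamma>"
    and a_unbounded: "filterlim (\<lambda>n::nat. len (a [^] n)) at_top sequentially"
    and b_unbounded: "filterlim (\<lambda>n::nat. len (b [^] n)) at_top sequentially"
    and ab_bdd: "bdd_above (power_products a b)"
    and a_large: "len a \<ge> 10 ^ 3 * len b"
    and b_large: "10 ^ 3 * len b > 10 ^ 6 * (3 + Sup (power_products a b))"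
    and \<Phi>_property_A: "\<And>g. g \<in> carrier \<Gamma> \<Longrightarrow> property_A a (\<Phi> g)"
    and \<Phi>_id: "\<And>g. property_A a g \<Longrightarrow> \<Phi> g = g"
    and \<Phi>_long: "\<And>g. g \<in> carrier \<Gamma> \<Longrightarrow> \<not> property_A a g \<Longrightarrow> len g \<ge> len a \<Longrightarrow>
          \<Phi> g \<in> {b \<otimes> g, g \<otimes> b, b \<otimes> g \<otimes> b}"
    and \<Phi>_short: "\<And>g. g \<in> carrier \<Gamma> \<Longrightarrow> \<not> property_A a g \<Longrightarrow> len g < len a \<Longrightarrow>
          \<Phi> g = b \<otimes> a \<otimes> b"


section \<open>The construction of F\<close>

locale tower_data = hyp_orbit \<Gamma> act x0
  for \<Gamma> :: "('g, 'm) monoid_scheme" (structure)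
    and act :: "'g \<Rightarrow> 'a::euclidean_space \<Rightarrow> 'a" and x0 :: 'a +
  fixes enum :: "nat \<Rightarrow> 'g" and a :: 'g and \<Phi> :: "'g \<Rightarrow> 'g"
    and K :: "'g set"
    and exc :: "nat \<Rightarrow> 'g" \<comment> \<open>the elements picked in \<open>excursions\<close>\<close>
    and \<beta> :: "nat \<Rightarrow> real"
begin

definition \<phi> :: "nat \<Rightarrow> 'g" where
  "\<phi> k = \<Phi> (exc k) \<otimes> a \<otimes> \<Phi> (enum k)"

definition F_step :: "nat \<Rightarrow> 'g set" where
  "F_step k = span_via \<Gamma> a (K \<union> \<phi> ` {1..<k})"

definition F_union :: "'g set" where
  "F_union = (\<Union>k\<in>{1..}. F_step k)"

text \<open>The real value of the Poincare series of \<open>F_step k\<close> at \<open>\<beta> j\<close>; it is used only for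
  \<open>j \<le> k\<close>, where \<open>\<beta> j\<close> exceeds the critical exponent and the series is finite.\<close>

definition P_val :: "nat \<Rightarrow> nat \<Rightarrow> real" where
  "P_val k j = enn2real (poincare_series (F_step k) (\<beta> j))"

end

text \<open>In the next locale \<open>R 0\<close> is the initial radius, and \<open>eps k j\<close> is the number
  \<open>\<epsilon>\<^sub>j\<close> picked at stage \<open>k\<close>. All sequences other than \<open>R\<close> are indexed from 1.\<close>

locale tower_construction =
  hyp_group_with_map \<Gamma> act x0 enum a b \<Phi> + tower_data \<Gamma> act x0 enum a \<Phi> K exc \<beta>
  for \<Gamma> :: "('g, 'm) monoid_scheme" (structure)
    and act :: "'g \<Rightarrow> 'a::euclidean_space \<Rightarrow> 'a" and x0 :: 'a
    and enum :: "nat \<Rightarrow> 'g" and a b :: 'g and \<Phi> :: "'g \<Rightarrow> 'g"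
    and K :: "'g set" and exc :: "nat \<Rightarrow> 'g" and \<beta> :: "nat \<Rightarrow> real" +
  fixes C \<epsilon> r0 :: real and R :: "nat \<Rightarrow> real" and eps :: "nat \<Rightarrow> nat \<Rightarrow> real"
  assumes C_def: "C = len a / 10 ^ 3"
    and \<epsilon>_bounds: "0 < \<epsilon>" "\<epsilon> < 1"
    and r0_nonneg: "0 \<le> r0"
    and r0: "\<And>r. r \<ge> r0 \<Longrightarrow>
          real (card (gball r)) \<le> exp ((1 + 0.001 * \<epsilon>) * crit_exp (carrier \<Gamma>) * r)"
    and R0_large: "R 0 > 10 ^ 7 * (C + r0) * (1 + crit_exp (carrier \<Gamma>))
                          / (crit_exp (carrier \<Gamma>) * \<epsilon>)"
    and R0_count: "real (card (gball (R 0) \<inter> \<Phi> ` carrier \<Gamma>))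
                     \<ge> exp ((1 - 0.001 * \<epsilon>) * crit_exp (carrier \<Gamma>) * R 0)"
    and K_subset: "K \<subseteq> (gball (R 0) \<inter> \<Phi> ` carrier \<Gamma>) - gball ((1 - 0.003 * \<epsilon>) * R 0)"
    and K_separated: "\<And>g h. g \<in> K \<Longrightarrow> h \<in> K \<Longrightarrow> g \<noteq> h \<Longrightarrow>
          hdist (act g x0) (act h x0) > 0.004 * \<epsilon> * R 0"
    and K_maximal: "\<And>K'. K \<subseteq> K' \<Longrightarrow>
          K' \<subseteq> (gball (R 0) \<inter> \<Phi> ` carrier \<Gamma>) - gball ((1 - 0.003 * \<epsilon>) * R 0) \<Longrightarrow>
          (\<forall>g\<in>K'. \<forall>h\<in>K'. g \<noteq> h \<longrightarrow> hdist (act g x0) (act h x0) > 0.004 * \<epsilon> * R 0) \<Longrightarrow>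
          K' = K"
    and \<beta>_1: "crit_exp (F_step 1) < \<beta> 1" "\<beta> 1 < crit_exp (F_step 1) + 0.5"
          "poincare_series (F_step 1) (\<beta> 1) > 2"
    and eps_bounds: "\<And>k j. 1 \<le> j \<Longrightarrow> j \<le> k \<Longrightarrow> 0 < eps k j"
          "\<And>k j. 1 \<le> j \<Longrightarrow> j \<le> k \<Longrightarrow> eps k j < 1 / 2"
          "\<And>k j. 1 \<le> j \<Longrightarrow> j \<le> k \<Longrightarrow> 2 * eps k j * P_val k j < 1"
          "\<And>k j. 1 \<le> j \<Longrightarrow> j \<le> k \<Longrightarrow>
             (P_val k j + 2 * eps k j + 4 * P_val k j * eps k j) / (1 - 2 * eps k j * P_val k j)
               < (2 - 2 powi (int j - int k - 1)) * P_val j j"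
    and R_growth: "\<And>k. 1 \<le> k \<Longrightarrow> R k > 100 * R (k - 1)"
    and R_contains: "\<And>k. 1 \<le> k \<Longrightarrow> K \<union> \<phi> ` {1..<k} \<subseteq> gball (R k - 10 ^ 4 * C)"
    and R_eps: "\<And>k j. 1 \<le> j \<Longrightarrow> j \<le> k \<Longrightarrow> exp (- \<beta> j * R k) \<le> eps k j"
    and exc: "\<And>k. 1 \<le> k \<Longrightarrow> exc k \<in> excursions (10 * C) - gball (R k + 2500 * C)"
    and \<beta>_Suc: "\<And>k. 1 \<le> k \<Longrightarrow> crit_exp (F_step (k + 1)) < \<beta> (k + 1)"
          "\<And>k. 1 \<le> k \<Longrightarrow>
             \<beta> (k + 1) < min (crit_exp (F_step (k + 1)) + (1 / 2) ^ (k + 1)) (\<beta> k)"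
          "\<And>k. 1 \<le> k \<Longrightarrow> poincare_series (F_step (k + 1)) (\<beta> (k + 1)) > 2 ^ (k + 1)"

end

(* Every element of F is a word g_1 a g_2 a ... a g_n whose prefixes lie, by Property (A), on a local
   quasi-geodesic, so that in a hyperbolic space the geodesic from x0 to the endpoint passes near
   every prefix. Hence if each letter phi_k with k >= N is shorter than c times the prefix before
   it, then at time T this geodesic is within c T + O(1) of the orbit.
   The elements violating this have the form u a phi_k a v with c |u| <= |phi_k|. Since
   lengths are superadditive, their weight in mu^s is at most
   const * sum_{k >= N} exp(-s |phi_k|) sum_{c |u| <= |phi_k|} exp(-s |u|). The inner sum
   grows more slowly than exp(delta |phi_k| / 2), as P_F converges at delta + c delta / 2, so the weight
   tends to 0 as N grows, uniformly in s. By weak convergence almost every xi is, for each c and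
   some N, a limit of elements without such a letter. *)
theory Submission
  imports Defs
begin

section \<open>Hyperbolic geometry in the ball model\<close>

text \<open>A bad word u a phi_k a v has two free factors, u and v, while the normalisation by
  P_F(s), which may blow up as s decreases to \<delta>, pays for only one. It pays for v; the sum
  over u must therefore be bounded at an exponent fixed above \<delta>. The missing exponent is
  borrowed from half of the weight of phi_k, and the other half has to be summable over k >= N. This
  rests on |phi_k| >= k and on \<delta> > 0. Positivity comes from K: the constants of the
  construction force K to have two elements, and a first letter in K can be recovered from the word,
  so P_F(s) >= 2 exp(-s B) P_F(s) with B = R_0 + |a|. Weights are only bounded from above, so
  enlarging the set of decompositions to a product set costs nothing. A boundary point has no word
  of its own. The ray estimate is transported from good elements converging to it, so its errors may
  depend on c and N but not on the element; the distance from the ray to a prefix is even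
  independent of c and N, which gives conicality.\<close>

lemma ptolemy_origin:
  fixes x y z :: "'a::real_inner"
  shows "norm (x - z) * norm y \<le> norm (x - y) * norm z + norm (y - z) * norm x"
proof (cases "x = 0 \<or> y = 0 \<or> z = 0")
  case True
  then show ?thesis by (auto simp: norm_minus_commute mult.commute)
next
  case False
  define i :: "'a \<Rightarrow> 'a" where "i v = v /\<^sub>R (norm v)\<^sup>2" for v
  \<comment> \<open>Inversion in the unit sphere scales the chord from u to v by 1 / (|u| |v|). The
    triangle inequality for the inverted points, multiplied by |x| |y| |z|, is the claim.\<close>
  have inv: "norm (i u - i v) = norm (u - v) / (norm u * norm v)" if "u \<noteq> 0" "v \<noteq> 0" for u v
  proof -
    define r s where "r = (norm u)\<^sup>2" and "s = (norm v)\<^sup>2"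
    have rs: "r = u \<bullet> u" "s = v \<bullet> v" "r \<noteq> 0" "s \<noteq> 0"
      using that by (simp_all add: r_def s_def power2_norm_eq_inner)
    have "(norm (i u - i v))\<^sup>2
        = inverse r * inverse r * (u \<bullet> u) - 2 * (inverse r * inverse s * (u \<bullet> v))
          + inverse s * inverse s * (v \<bullet> v)"
      unfolding i_def r_def s_def power2_norm_eq_inner
      by (simp add: inner_diff_left inner_diff_right inner_commute mult_ac)
    also have "\<dots> = (u \<bullet> u - 2 * (u \<bullet> v) + v \<bullet> v) / (r * s)"
      unfolding rs(1,2)[symmetric] using rs(3,4) by (simp add: field_simps)
    also have "\<dots> = (norm (u - v) / (norm u * norm v))\<^sup>2"
      unfolding r_def s_def power_divide power_mult_distrib
      by (simp add: power2_norm_eq_inner inner_diff_left inner_diff_right inner_commute)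
    finally have "(norm (i u - i v))\<^sup>2 = (norm (u - v) / (norm u * norm v))\<^sup>2" .
    then show ?thesis by (simp add: power2_eq_iff_nonneg)
  qed
  have "norm (i x - i z) \<le> norm (i x - i y) + norm (i y - i z)"
    using norm_triangle_ineq[of "i x - i y" "i y - i z"] by simp
  then have "norm (x - z) / (norm x * norm z)
      \<le> norm (x - y) / (norm x * norm y) + norm (y - z) / (norm y * norm z)"
    using False by (simp add: inv)
  then show ?thesis using False by (simp add: field_simps)
qed

lemma ptolemy:
  fixes x y z w :: "'a::real_inner"
  shows "norm (x - z) * norm (y - w) \<le> norm (x - y) * norm (z - w) + norm (y - z) * norm (x - w)"
  using ptolemy_origin[of "x - w" "z - w" "y - w"] by simp

section \<open>Hyperbolic distance through Euclidean chords\<close>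

lemma hyp_iff: "x \<in> hyp \<longleftrightarrow> norm x < 1"
  by (simp add: hyp_def)

lemma hyp_gap: "x \<in> hyp \<Longrightarrow> 0 < 1 - (norm x)\<^sup>2"
  by (metis hyp_iff abs_norm_cancel abs_square_less_1 diff_gt_0_iff_gt)

lemma cosh_hdist:
  assumes "x \<in> hyp" "y \<in> hyp"
  shows "cosh (hdist x y) = 1 + 2 * (norm (x - y))\<^sup>2 / ((1 - (norm x)\<^sup>2) * (1 - (norm y)\<^sup>2))"
  unfolding hdist_def using hyp_gap[OF assms(1)] hyp_gap[OF assms(2)]
  by (intro cosh_arcosh_real) simp

lemma hdist_nonneg:
  assumes "x \<in> hyp" "y \<in> hyp"
  shows "0 \<le> hdist x y"
  unfolding hdist_def using hyp_gap[OF assms(1)] hyp_gap[OF assms(2)]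
  by (intro arcosh_nonneg_real) simp

lemma hdist_commute: "hdist x y = hdist y x"
  by (simp add: hdist_def norm_minus_commute mult.commute)

lemma hdist_self [simp]: "hdist x x = 0"
  by (simp add: hdist_def)

text \<open>The reciprocal of cosh(hdist 0 x / 2). With the square root, sinh of half a distance
  becomes a chord divided by one weight per point, and these weights cancel in inequalities such as
  Ptolemy's.\<close>

definition hgap :: "'a::euclidean_space \<Rightarrow> real" where
  "hgap x = sqrt (1 - (norm x)\<^sup>2)"

lemma hgap_pos: "x \<in> hyp \<Longrightarrow> 0 < hgap x"
  using hyp_gap[of x] by (simp add: hgap_def)

lemma hgap_square: "x \<in> hyp \<Longrightarrow> (hgap x)\<^sup>2 = 1 - (norm x)\<^sup>2"
  using hyp_gap[of x] by (simp add: hgap_def)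

lemma sinh_half_hdist:
  assumes "x \<in> hyp" "y \<in> hyp"
  shows "sinh (hdist x y / 2) = norm (x - y) / (hgap x * hgap y)"
proof -
  have "cosh (hdist x y) = 1 + 2 * (sinh (hdist x y / 2))\<^sup>2"
    using cosh_double[of "hdist x y / 2"] by (simp add: cosh_square_eq)
  then have "(sinh (hdist x y / 2))\<^sup>2 = (norm (x - y) / (hgap x * hgap y))\<^sup>2"
    using cosh_hdist[OF assms] assms by (simp add: hgap_square power_divide power_mult_distrib)
  then show ?thesis
    using hdist_nonneg[OF assms] hgap_pos[OF assms(1)] hgap_pos[OF assms(2)]
    by (subst (asm) power2_eq_iff_nonneg) auto
qed

lemma cosh_half_hdist:
  assumes "x \<in> hyp" "y \<in> hyp"
  shows "(cosh (hdist x y / 2))\<^sup>2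
    = (1 - 2 * (x \<bullet> y) + (norm x)\<^sup>2 * (norm y)\<^sup>2) / (hgap x * hgap y)\<^sup>2"
proof -
  have "(cosh (hdist x y / 2))\<^sup>2 = 1 + (norm (x - y))\<^sup>2 / (hgap x * hgap y)\<^sup>2"
    using sinh_half_hdist[OF assms] by (simp add: cosh_square_eq power_divide)
  also have "\<dots> = ((hgap x)\<^sup>2 * (hgap y)\<^sup>2 + (norm (x - y))\<^sup>2) / (hgap x * hgap y)\<^sup>2"
    using hgap_pos[OF assms(1)] hgap_pos[OF assms(2)]
    by (simp add: field_simps power_mult_distrib)
  also have "(hgap x)\<^sup>2 * (hgap y)\<^sup>2 + (norm (x - y))\<^sup>2
      = 1 - 2 * (x \<bullet> y) + (norm x)\<^sup>2 * (norm y)\<^sup>2"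
    using assms by (simp add: hgap_square power2_norm_eq_inner algebra_simps inner_commute)
  finally show ?thesis .
qed

text \<open>The numerator in \<open>cosh_half_hdist\<close> is |y|^2 times the squared chord from x
  to the inverse point of y. Chords to the inverse point thus measure cosh as chords to y measure
  sinh.\<close>

lemma cosh_half_hdist_inversion:
  assumes "x \<in> hyp" "y \<in> hyp" "y \<noteq> 0"
  shows "norm (x - y /\<^sub>R (norm y)\<^sup>2) = cosh (hdist x y / 2) * (hgap x * hgap y) / norm y"
proof -
  define s where "s = (norm y)\<^sup>2"
  have s: "s = y \<bullet> y" "s \<noteq> 0" using assms(3) by (simp_all add: s_def power2_norm_eq_inner)
  have "(norm (x - y /\<^sub>R s))\<^sup>2
      = x \<bullet> x - 2 * (inverse s * (x \<bullet> y)) + inverse s * inverse s * (y \<bullet> y)"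
    unfolding power2_norm_eq_inner by (simp add: inner_diff_left inner_diff_right inner_commute)
  also have "\<dots> = (1 - 2 * (x \<bullet> y) + x \<bullet> x * s) / s"
    unfolding s(1)[symmetric] using s(2) by (simp add: field_simps)
  finally have "(norm (x - y /\<^sub>R (norm y)\<^sup>2))\<^sup>2
      = (1 - 2 * (x \<bullet> y) + (norm x)\<^sup>2 * (norm y)\<^sup>2) / (norm y)\<^sup>2"
    by (simp add: s_def power2_norm_eq_inner)
  also have "\<dots> = (cosh (hdist x y / 2) * (hgap x * hgap y) / norm y)\<^sup>2"
    using cosh_half_hdist[OF assms(1,2)] hgap_pos[OF assms(1)] hgap_pos[OF assms(2)]
    by (simp add: power_mult_distrib power_divide)
  finally show ?thesis
    using hgap_pos[OF assms(1)] hgap_pos[OF assms(2)]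
    by (subst (asm) power2_eq_iff_nonneg) (auto simp: less_imp_le)
qed

text \<open>Ptolemy's inequality for \<open>x\<close>, \<open>y\<close>, \<open>z\<close> and the image of \<open>y\<close> under inversion in the unit
  sphere is the addition formula bound for \<open>sinh\<close> at half distances.\<close>

lemma hdist_triangle:
  assumes x: "x \<in> hyp" and y: "y \<in> hyp" and z: "z \<in> hyp"
  shows "hdist x z \<le> hdist x y + hdist y z"
proof -
  note g = hgap_pos[OF x] hgap_pos[OF y] hgap_pos[OF z]
  have "norm (x - z) / (hgap x * hgap z)
      \<le> sinh (hdist x y / 2) * cosh (hdist y z / 2) + cosh (hdist x y / 2) * sinh (hdist y z / 2)"
  proof (cases "y = 0")
    \<comment> \<open>The inverse point of the origin is at infinity. Here the explicit value
      cosh(hdist v 0 / 2) = 1 / \<open>hgap v\<close> reduces the claim to the Euclidean triangle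
      inequality.\<close>
    case True
    have c: "cosh (hdist v 0 / 2) = 1 / hgap v" if "v \<in> hyp" for v :: 'a
    proof -
      have "(cosh (hdist v 0 / 2))\<^sup>2 = (1 / hgap v)\<^sup>2"
        using cosh_half_hdist[OF that, of 0] by (simp add: hyp_iff hgap_def power_divide)
      then show ?thesis using hgap_pos[OF that] by (subst (asm) power2_eq_iff_nonneg) auto
    qed
    have h0: "hgap (0::'a) = 1" by (simp add: hgap_def)
    have "norm (x - z) / (hgap x * hgap z) \<le> (norm x + norm z) / (hgap x * hgap z)"
      using norm_triangle_ineq4[of x z] g by (intro divide_right_mono) auto
    also have "\<dots> = norm x / hgap x * (1 / hgap z) + 1 / hgap x * (norm z / hgap z)"
      by (simp add: add_divide_distrib)
    finally show ?thesis
      using sinh_half_hdist[OF x y] sinh_half_hdist[OF z y] c[OF x] c[OF z]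
      unfolding True h0 by (simp add: hdist_commute[of 0])
  next
    case False
    define y' where "y' = y /\<^sub>R (norm y)\<^sup>2"
    have yy: "norm (y - y') = (hgap y)\<^sup>2 / norm y"
      using cosh_half_hdist_inversion[OF y y False] unfolding y'_def
      by (simp add: power2_eq_square)
    have "norm (x - z) * norm (y - y') \<le> norm (x - y) * norm (z - y') + norm (y - z) * norm (x - y')"
      by (rule ptolemy)
    also have "\<dots> = norm (x - y) * (cosh (hdist y z / 2) * (hgap y * hgap z) / norm y)
        + norm (y - z) * (cosh (hdist x y / 2) * (hgap x * hgap y) / norm y)"
      using cosh_half_hdist_inversion[OF x y False] cosh_half_hdist_inversion[OF z y False]
      unfolding y'_def by (simp add: hdist_commute mult.commute)
    finally have "norm (x - z) * (hgap y)\<^sup>2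
        \<le> norm (x - y) * cosh (hdist y z / 2) * (hgap y * hgap z)
          + norm (y - z) * cosh (hdist x y / 2) * (hgap x * hgap y)"
      unfolding yy using False by (simp add: field_simps)
    then have "hgap y * (norm (x - z) * hgap y)
        \<le> hgap y * (norm (x - y) * cosh (hdist y z / 2) * hgap z
          + norm (y - z) * cosh (hdist x y / 2) * hgap x)"
      by (simp add: power2_eq_square algebra_simps)
    then have "norm (x - z) * hgap y
        \<le> norm (x - y) * cosh (hdist y z / 2) * hgap z + norm (y - z) * cosh (hdist x y / 2) * hgap x"
      using g by (simp only: mult_le_cancel_left_pos)
    then show ?thesis
      using g unfolding sinh_half_hdist[OF x y] sinh_half_hdist[OF y z]
      by (simp add: field_simps)
  qed
  then have "sinh (hdist x z / 2) \<le> sinh (hdist x y / 2 + hdist y z / 2)"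
    by (simp add: sinh_half_hdist[OF x z] sinh_add)
  then show ?thesis by simp
qed

text \<open>The factor 0.8 is a lower bound for 1 - exp(-d), since exp 2 >= 5.\<close>

lemma sinh_ge_exp:
  fixes d :: real
  assumes "2 \<le> d"
  shows "0.8 * exp (d / 2) \<le> 2 * sinh (d / 2)"
proof -
  have "exp (-(d/2)) = exp (- d) * exp (d / 2)" by (simp flip: exp_add)
  also have "exp (- d) \<le> exp (-2)" using assms by simp
  also have "exp (-2::real) \<le> 0.2"
  proof -
    have "(2::real) * 2.5 \<le> exp 2"
      using exp_lower_Taylor_quadratic[of "2::real"] by simp
    then show ?thesis by (simp add: exp_minus field_simps)
  qed
  finally show ?thesis by (simp add: sinh_def)
qed

text \<open>Dividing Ptolemy's inequality by the common product of the four factors \<open>hgap\<close> gives the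
  four-point condition for \<open>sinh\<close> at half distances; distances below 2 are trivial.\<close>

lemma hdist_four_point:
  assumes x: "x \<in> hyp" and y: "y \<in> hyp" and z: "z \<in> hyp" and w: "w \<in> hyp"
  shows "hdist x z + hdist y w \<le> max (hdist x y + hdist z w) (hdist y z + hdist x w) + 4"
proof (cases "hdist x z \<le> 2 \<or> hdist y w \<le> 2")
  case True
  then show ?thesis
    using hdist_triangle[OF y x w] hdist_triangle[OF x z w] hdist_triangle[OF x y z]
      hdist_triangle[OF y w z] hdist_commute[of x y] hdist_commute[of z w] by linarith
next
  case False
  let ?s = "\<lambda>x y. 2 * sinh (hdist x y / 2)"
  let ?M = "max (hdist x y + hdist z w) (hdist y z + hdist x w)"
  have up: "?s u v \<le> exp (hdist u v / 2)" for u v :: 'a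
    by (simp add: sinh_def)
  have nn: "0 \<le> ?s u v" if "u \<in> hyp" "v \<in> hyp" for u v :: 'a
    using hdist_nonneg[OF that] by simp
  have "0.64 * exp ((hdist x z + hdist y w) / 2) = (0.8 * exp (hdist x z / 2)) * (0.8 * exp (hdist y w / 2))"
    by (simp add: add_divide_distrib exp_add)
  also have "\<dots> \<le> ?s x z * ?s y w"
    using False nn[OF x z] by (intro mult_mono sinh_ge_exp) auto
  also have "\<dots> \<le> ?s x y * ?s z w + ?s y z * ?s x w"
    using ptolemy[of x z y w] hgap_pos[OF x] hgap_pos[OF y] hgap_pos[OF z] hgap_pos[OF w]
    by (simp add: sinh_half_hdist assms field_simps)
  also have "\<dots> \<le> exp (hdist x y / 2) * exp (hdist z w / 2) + exp (hdist y z / 2) * exp (hdist x w / 2)"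
    using up nn assms by (intro add_mono mult_mono) auto
  also have "\<dots> = exp ((hdist x y + hdist z w) / 2) + exp ((hdist y z + hdist x w) / 2)"
    by (simp add: add_divide_distrib exp_add)
  also have "\<dots> \<le> 2 * exp (?M / 2)"
  proof -
    have "exp ((hdist x y + hdist z w) / 2) \<le> exp (?M / 2)"
      "exp ((hdist y z + hdist x w) / 2) \<le> exp (?M / 2)"
      by (simp_all only: exp_le_cancel_iff, simp_all only: divide_right_mono max.cobounded1
          max.cobounded2 zero_le_numeral)
    then show ?thesis by linarith
  qed
  finally have "exp ((hdist x z + hdist y w) / 2) \<le> 2 / 0.64 * exp (?M / 2)" by simp
  \<comment> \<open>2 / 0.64 = 3.125 is at most 5 <= exp 2. In the exponent, where distances are
    halved, this factor is the additive constant 4.\<close>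
  also have "\<dots> \<le> exp 2 * exp (?M / 2)"
    using exp_lower_Taylor_quadratic[of "2::real"] by (intro mult_right_mono) auto
  also have "\<dots> = exp ((?M + 4) / 2)" by (simp add: add_divide_distrib exp_add)
  finally show ?thesis by simp
qed

section \<open>Gromov products and the passage from local to global quasi-geodesics\<close>

lemma gromov_prod_commute: "gromov_prod z x y = gromov_prod z y x"
  unfolding gromov_prod_def using hdist_commute by (metis add.commute)

lemma gromov_prod_hyperbolic:
  assumes "x \<in> hyp" "y \<in> hyp" "z \<in> hyp" "w \<in> hyp"
  shows "min (gromov_prod w x y) (gromov_prod w y z) \<le> gromov_prod w x z + 2"
  using hdist_four_point[OF assms] hdist_commute[of y w] hdist_commute[of z w]
  unfolding gromov_prod_def by (auto simp: min_def max_def field_simps split: if_splits)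

text \<open>Trades a small product at one end of a long side for a large product at its other
  end.\<close>

lemma gromov_prod_swap: "gromov_prod x z y = hdist z x - gromov_prod z x y"
  unfolding gromov_prod_def hdist_commute[of y z] hdist_commute[of x z] by (simp add: field_simps)

text \<open>A small product at \<open>p i\<close> and a long edge give a product of at least L - (e
  + 2) at \<open>p (i + 1)\<close> between \<open>p i\<close> and \<open>p 0\<close>. This member of
  the hyperbolic minimum is too large, so the other one obeys the bound. The loss of 2 does not
  accumulate, because each step starts afresh from the local bound e.\<close>

lemma chain_initial:
  fixes p :: "nat \<Rightarrow> 'a::euclidean_space"
  assumes hyp: "\<And>i. i \<le> m \<Longrightarrow> p i \<in> hyp"
    and far: "\<And>i. i < m \<Longrightarrow> L \<le> hdist (p i) (p (i + 1))"
    and turn: "\<And>i. i + 2 \<le> m \<Longrightarrow> gromov_prod (p (i + 1)) (p i) (p (i + 2)) \<le> e"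
    and L: "2 * e + 6 < L" 
    and i: "0 < i" "i < m"
  shows "gromov_prod (p i) (p 0) (p (i + 1)) \<le> e + 2"
  using i
proof (induction i rule: nat_induct_non_zero)
  case 1
  then show ?case using turn[of 0] by (simp add: numeral_2_eq_2)
next
  case (Suc i)
  then have "gromov_prod (p i) (p 0) (p (i + 1)) \<le> e + 2" by simp
  then have "L - (e + 2) \<le> gromov_prod (p (i + 1)) (p i) (p 0)"
    using gromov_prod_swap[of "p (i + 1)" "p i" "p 0"] far[of i] Suc
      gromov_prod_commute[of "p i" "p 0"] by simp
  moreover have "min (gromov_prod (p (i+1)) (p i) (p 0)) (gromov_prod (p (i+1)) (p 0) (p (i+2))) \<le> e + 2"
    using gromov_prod_hyperbolic[of "p i" "p 0" "p (i + 2)" "p (i + 1)"] turn[of i] hyp Suc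
    by simp
  ultimately show ?case using L by (auto simp: min_def split: if_splits)
qed

text \<open>\<open>chain_initial\<close> is run forwards up to the predecessor of \<open>p i\<close>
  and backwards on the reversed sequence; joining both at \<open>p i\<close> costs another 2. The
  hypothesis \<open>2 * e + 6 < L\<close> says that L - (e + 2) exceeds e + 4.\<close>

lemma chain_gromov_prod:
  fixes p :: "nat \<Rightarrow> 'a::euclidean_space"
  assumes hyp: "\<And>i. i \<le> m \<Longrightarrow> p i \<in> hyp"
    and far: "\<And>i. i < m \<Longrightarrow> L \<le> hdist (p i) (p (i + 1))"
    and turn: "\<And>i. i + 2 \<le> m \<Longrightarrow> gromov_prod (p (i + 1)) (p i) (p (i + 2)) \<le> e"
    and L: "2 * e + 6 < L"
    and i: "0 < i" "i < m"
  shows "gromov_prod (p i) (p 0) (p m) \<le> e + 4"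
proof -
  have rev: "gromov_prod (p (m - j)) (p m) (p (m - (j + 1))) \<le> e + 2" if "0 < j" "j < m" for j
  proof -
    have 1: "L \<le> hdist (p (m - k)) (p (m - (k + 1)))" if "k < m" for k
    proof -
      have "m - k = m - (k + 1) + 1" using that by simp
      then show ?thesis using far[of "m - (k + 1)"] hdist_commute that
        by (metis Suc_eq_plus1 diff_less less_nat_zero_code not_gr_zero zero_less_Suc)
    qed
    have 2: "gromov_prod (p (m - (k + 1))) (p (m - k)) (p (m - (k + 2))) \<le> e" if "k + 2 \<le> m" for k
    proof -
      define l where "l = m - (k + 2)"
      have "m - (k + 1) = l + 1" "m - k = l + 2" "l + 2 \<le> m" using that by (auto simp: l_def)
      then show ?thesis using turn[of l] gromov_prod_commute l_def by metis
    qed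
    show ?thesis
      using chain_initial[where p = "\<lambda>j. p (m - j)" and m = m and L = L and e = e, OF _ 1 2 L that] hyp
      by simp
  qed
  show ?thesis
  proof (cases "i = 1")
    \<comment> \<open>The predecessor of \<open>p 1\<close> is already the end point
      \<open>p 0\<close>, so the reversed estimate alone suffices.\<close>
    case True
    then show ?thesis using rev[of "m - i"] i gromov_prod_commute[of "p i" "p m"] by simp
  next
    case False
    then obtain k where k: "i = Suc k" "0 < k" using i by (cases i) auto
    have "gromov_prod (p k) (p 0) (p (k + 1)) \<le> e + 2"
      using chain_initial[of m p L e k, OF assms(1-4)] k i by simp
    then have "L - (e + 2) \<le> gromov_prod (p i) (p k) (p 0)"
      using gromov_prod_swap[of "p i" "p k" "p 0"] far[of k] k i gromov_prod_commute[of "p k" "p 0"]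
      by simp
    moreover have "gromov_prod (p i) (p k) (p m) \<le> e + 2"
      using rev[of "m - i"] i k gromov_prod_commute[of "p i" "p k"] by simp
    moreover have "min (gromov_prod (p i) (p k) (p 0)) (gromov_prod (p i) (p 0) (p m))
        \<le> gromov_prod (p i) (p k) (p m) + 2"
      using i k by (intro gromov_prod_hyperbolic hyp) auto
    ultimately show ?thesis using L by (auto simp: min_def split: if_splits)
  qed
qed

section \<open>Points near the boundary sphere and rays towards it\<close>

lemma hyp_bounded_in_cball:
  assumes "x0 \<in> hyp"
  obtains \<rho> where "\<rho> < 1" "\<And>y. y \<in> hyp \<Longrightarrow> hdist x0 y < r \<Longrightarrow> norm y \<le> \<rho>"
proof -
  define M where "M = cosh (hdist 0 x0 + \<bar>r\<bar>)"
  have M: "M \<ge> 1" by (simp add: M_def cosh_real_ge_1)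
  have 0: "(0::'a) \<in> hyp" by (simp add: hyp_iff)
  have "norm y \<le> sqrt (1 - 1 / M)" if y: "y \<in> hyp" "hdist x0 y < r" for y
  proof -
    have "cosh (hdist 0 y) \<le> M"
      unfolding M_def using hdist_triangle[OF 0 assms y(1)] hdist_nonneg[OF 0 y(1)] y(2)
      by (intro cosh_real_nonneg_le_iff[THEN iffD2]) (auto simp: hdist_nonneg[OF 0 assms])
    \<comment> \<open>From the origin, cosh(hdist 0 y) = (1 + |y|^2) / (1 - |y|^2), so a bound on
      the distance keeps |y| away from 1.\<close>
    moreover have "1 / (1 - (norm y)\<^sup>2) \<le> cosh (hdist 0 y)"
      using cosh_hdist[OF 0 y(1)] hyp_gap[OF y(1)] by (simp add: divide_simps)
    ultimately have "1 / (1 - (norm y)\<^sup>2) \<le> M" by simp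
    then have "1 / M \<le> 1 - (norm y)\<^sup>2" using M hyp_gap[OF y(1)]
      by (simp add: pos_divide_le_eq mult.commute)
    then show ?thesis by (simp add: real_le_rsqrt)
  qed
  moreover have "sqrt (1 - 1 / M) < 1" using M by (simp add: real_less_lsqrt)
  ultimately show thesis using that by blast
qed

text \<open>Near \<xi> the product of the gaps 1 - |v|^2 and the squared chord are both O(\<eta>),
  while 1 / (1 - |v|^2) <= exp(hdist 0 v). Hence exp(hdist x y) is smaller than exp(hdist 0 x +
  hdist 0 y) by any prescribed factor.\<close>

lemma gromov_prod_at_boundary:
  assumes x0: "x0 \<in> hyp" and \<xi>: "\<xi> \<in> hyp_boundary"
  obtains \<eta> where "\<eta> > 0" "\<And>x y. x \<in> hyp \<Longrightarrow> y \<in> hyp \<Longrightarrow> dist x \<xi> < \<eta> \<Longrightarrow> dist y \<xi> < \<eta> \<Longrightarrow>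
      T \<le> gromov_prod x0 x y"
proof -
  have 0: "(0::'a) \<in> hyp" by (simp add: hyp_iff)
  \<comment> \<open>Moving the base point from 0 to \<open>x0\<close> changes a Gromov product by at
    most \<open>hdist 0 x0\<close>.\<close>
  define S where "S = \<bar>T\<bar> + hdist 0 x0"
  have S: "0 \<le> S" by (simp add: S_def hdist_nonneg[OF 0 x0])
  \<comment> \<open>24 = 2 * 4 + 4 * 4 collects the two terms of 2 cosh(hdist x y), each controlled
    by 4 \<eta>.\<close>
  define \<eta> where "\<eta> = exp (- 2 * S) / 24"
  have "exp (- 2 * S) \<le> 1" using S by simp
  then have \<eta>: "0 < \<eta>" "\<eta> \<le> 1" unfolding \<eta>_def by (simp, linarith)
  have "T \<le> gromov_prod x0 x y" if x: "x \<in> hyp" and y: "y \<in> hyp" and dx: "dist x \<xi> < \<eta>" and dy: "dist y \<xi> < \<eta>" for x y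
  proof -
    have gap: "1 - (norm v)\<^sup>2 \<le> 2 * \<eta>" if "v \<in> hyp" "dist v \<xi> < \<eta>" for v
    proof -
      have "1 - norm v \<le> \<eta>"
        using norm_triangle_ineq2[of \<xi> v] that(2) \<xi> by (simp add: hyp_boundary_def dist_norm norm_minus_commute)
      moreover have "1 - (norm v)\<^sup>2 = (1 - norm v) * (1 + norm v)" by (simp add: algebra_simps power2_eq_square)
      moreover have "(1 - norm v) * (1 + norm v) \<le> (1 - norm v) * 2"
        using that(1) by (intro mult_left_mono) (auto simp: hyp_iff)
      ultimately show ?thesis by argo
    qed
    let ?p = "1 - (norm x)\<^sup>2" and ?q = "1 - (norm y)\<^sup>2"
    have p: "0 < ?p" "?p \<le> 2 * \<eta>" and q: "0 < ?q" "?q \<le> 2 * \<eta>"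
      using gap x y dx dy hyp_gap by auto
    have exp_ge: "1 / (1 - (norm v)\<^sup>2) \<le> exp (hdist 0 v)" if "v \<in> hyp" for v :: 'a
    proof -
      have "1 / (1 - (norm v)\<^sup>2) \<le> cosh (hdist 0 v)"
        using cosh_hdist[OF 0 that] hyp_gap[OF that] by (simp add: divide_simps)
      also have "\<dots> \<le> exp (hdist 0 v)" using hdist_nonneg[OF 0 that] by (simp add: cosh_def)
      finally show ?thesis .
    qed
    have xy: "(norm (x - y))\<^sup>2 \<le> 4 * \<eta>"
    proof -
      have "norm (x - y) \<le> 2 * \<eta>" using dist_triangle3[of x y \<xi>] dx dy
        by (simp add: dist_norm norm_minus_commute)
      then have "(norm (x - y))\<^sup>2 \<le> (2 * \<eta>)\<^sup>2" by (intro power_mono) auto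
      also have "\<dots> \<le> 4 * \<eta>" using \<eta> by (simp add: power2_eq_square)
      finally show ?thesis .
    qed
    have pq: "?p * ?q \<le> 4 * \<eta>"
    proof -
      have "?p * ?q \<le> (2 * \<eta>) * 1" using p q by (intro mult_mono) auto
      then show ?thesis using \<eta> by simp
    qed
    have "exp (hdist x y) \<le> 2 * cosh (hdist x y)" by (simp add: cosh_def)
    also have "\<dots> = (2 * (?p * ?q) + 4 * (norm (x - y))\<^sup>2) / (?p * ?q)"
      using cosh_hdist[OF x y] p q by (simp add: add_divide_distrib)
    also have "\<dots> \<le> (24 * \<eta>) / (?p * ?q)"
      using pq xy p q by (intro divide_right_mono) auto
    also have "\<dots> = exp (- 2 * S) * (1 / ?p * (1 / ?q))" by (simp add: \<eta>_def)
    also have "\<dots> \<le> exp (- 2 * S) * (exp (hdist 0 x) * exp (hdist 0 y))"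
      using exp_ge[OF x] exp_ge[OF y] p q by (intro mult_left_mono mult_mono) auto
    finally have "hdist x y \<le> - 2 * S + (hdist 0 x + hdist 0 y)"
      by (simp flip: exp_add)
    then show ?thesis
      using hdist_triangle[OF 0 x0 x] hdist_triangle[OF 0 x0 y] hdist_commute[of x0 x]
      unfolding gromov_prod_def S_def by (simp add: field_simps)
  qed
  with \<eta> show thesis using that by blast
qed

text \<open>In the hyperboloid model, with \<open>X\<^sub>0\<close> the base point and \<open>N = (1, \<xi>)\<close> the null vector of the
  boundary point, the ray is \<open>exp (- t) X\<^sub>0 + (sinh t / c) N\<close> where \<open>c = - \<langle>X\<^sub>0, N\<rangle>\<close>; the ball model
  is the projection \<open>(T, S) \<mapsto> S / (1 + T)\<close>.\<close>

lemma hyperboloid_to_ball: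
  fixes S S' :: "'a::euclidean_space"
  assumes T: "T > 0" "T\<^sup>2 = 1 + (norm S)\<^sup>2" and T': "T' > 0" "T'\<^sup>2 = 1 + (norm S')\<^sup>2"
  shows "S /\<^sub>R (1 + T) \<in> hyp" "hdist (S /\<^sub>R (1 + T)) (S' /\<^sub>R (1 + T')) = arcosh (T * T' - S \<bullet> S')"
proof -
  have gap: "1 - (norm (U /\<^sub>R (1 + W)))\<^sup>2 = 2 / (1 + W)" if W: "W > 0" "W\<^sup>2 = 1 + (norm U)\<^sup>2" for W and U :: 'a
  proof -
    have "(norm (U /\<^sub>R (1 + W)))\<^sup>2 = (W\<^sup>2 - 1) / (1 + W)\<^sup>2" using W by (simp add: power_divide field_simps)
    also have "\<dots> = (W - 1) / (W + 1)"
      using W by (simp add: power2_eq_square divide_simps) (simp add: algebra_simps)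
    finally show ?thesis using W by (simp add: field_simps)
  qed
  have "0 < 1 - (norm (S /\<^sub>R (1 + T)))\<^sup>2" unfolding gap[OF T] using T by simp
  then show "S /\<^sub>R (1 + T) \<in> hyp" unfolding hyp_iff
    by (metis abs_norm_cancel abs_square_less_1 diff_gt_0_iff_gt)
  have "(norm (S /\<^sub>R (1 + T) - S' /\<^sub>R (1 + T')))\<^sup>2
      = (T\<^sup>2 - 1) / (1 + T)\<^sup>2 + (T'\<^sup>2 - 1) / (1 + T')\<^sup>2 - 2 * (S \<bullet> S') / ((1 + T) * (1 + T'))"
    unfolding T T' power2_norm_eq_inner inner_diff_left inner_diff_right
    by (simp add: inner_commute power2_eq_square divide_inverse)
  also have "(T\<^sup>2 - 1) / (1 + T)\<^sup>2 = (T - 1) / (1 + T)"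
    using T by (simp add: power2_eq_square divide_simps) (simp add: algebra_simps)
  also have "(T'\<^sup>2 - 1) / (1 + T')\<^sup>2 = (T' - 1) / (1 + T')"
    using T' by (simp add: power2_eq_square divide_simps) (simp add: algebra_simps)
  also have "(T - 1) / (1 + T) + (T' - 1) / (1 + T') - 2 * (S \<bullet> S') / ((1 + T) * (1 + T'))
      = 2 * (T * T' - S \<bullet> S' - 1) / ((1 + T) * (1 + T'))"
    using T T' by (simp add: divide_simps) (simp add: algebra_simps)
  finally have "1 + 2 * (norm (S /\<^sub>R (1 + T) - S' /\<^sub>R (1 + T')))\<^sup>2 / (2 / (1 + T) * (2 / (1 + T')))
      = T * T' - S \<bullet> S'"
    using T T' by (simp del: divide_eq_eq) (simp add: field_simps)
  then show "hdist (S /\<^sub>R (1 + T)) (S' /\<^sub>R (1 + T')) = arcosh (T * T' - S \<bullet> S')"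
    unfolding hdist_def gap[OF T] gap[OF T'] by simp
qed

lemma hray_exists:
  fixes x0 \<xi> :: "'a::euclidean_space"
  assumes x0: "x0 \<in> hyp" and \<xi>: "\<xi> \<in> hyp_boundary"
  obtains \<gamma> where "hray x0 \<xi> \<gamma>"
proof -
  define g where "g = 1 - (norm x0)\<^sup>2"
  have g: "g > 0" using hyp_gap[OF x0] by (simp add: g_def)
  \<comment> \<open>\<open>(T0, S0)\<close> is the point of the hyperboloid that projects to
    \<open>x0\<close>.\<close>
  define T0 where "T0 = (1 + (norm x0)\<^sup>2) / g"
  define S0 where "S0 = (2 / g) *\<^sub>R x0"
  define c where "c = T0 - S0 \<bullet> \<xi>"
  have n\<xi>: "\<xi> \<bullet> \<xi> = 1" using \<xi> by (simp add: hyp_boundary_def norm_eq_1)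
  have T0: "T0 > 0" "T0\<^sup>2 = 1 + S0 \<bullet> S0"
  proof -
    show "T0 > 0" using g by (simp add: T0_def add_pos_nonneg)
    have "(1 + (norm x0)\<^sup>2)\<^sup>2 = g\<^sup>2 + 4 * (x0 \<bullet> x0)"
      unfolding dot_square_norm g_def power2_eq_square by algebra
    then have "T0\<^sup>2 = (g\<^sup>2 + 4 * (x0 \<bullet> x0)) / g\<^sup>2" by (simp add: T0_def power_divide)
    also have "\<dots> = 1 + S0 \<bullet> S0"
      using g by (simp add: S0_def power2_eq_square add_divide_distrib)
    finally show "T0\<^sup>2 = 1 + S0 \<bullet> S0" .
  qed
  have c: "c > 0"
  proof -
    have "S0 \<bullet> \<xi> \<le> norm S0" using norm_cauchy_schwarz[of S0 \<xi>] \<xi> by (simp add: hyp_boundary_def)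
    moreover have "norm S0 < T0"
    proof (rule power2_less_imp_less)
      show "(norm S0)\<^sup>2 < T0\<^sup>2" unfolding T0(2) dot_square_norm by simp
    qed (use T0(1) in simp)
    ultimately show ?thesis by (simp add: c_def)
  qed
  define T where "T t = exp (- t) * T0 + sinh t / c" for t
  define S where "S t = exp (- t) *\<^sub>R S0 + (sinh t / c) *\<^sub>R \<xi>" for t
  define \<gamma> where "\<gamma> t = S t /\<^sub>R (1 + T t)" for t
  have Tpos: "T t > 0" if "t \<ge> 0" for t
    unfolding T_def using T0 c that by (intro add_pos_nonneg) auto
  \<comment> \<open>This is minus the Lorentz product of two points of the curve. Expanding with
    <X_0, X_0> = -1 and <N, N> = 0 leaves cosh(s - t), so the curve lies on the hyperboloid and has
    unit speed.\<close>
  have form: "T s * T t - S s \<bullet> S t = cosh (s - t)" for s t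
  proof -
    have e: "exp (- s) * exp s = 1" "exp (- t) * exp t = 1" by (simp_all flip: exp_add)
    define x y where "x = sinh s / c" and "y = sinh t / c"
    have xy: "x * c = sinh s" "y * c = sinh t" using c by (simp_all add: x_def y_def)
    have "T s * T t - S s \<bullet> S t = exp (- s) * exp (- t) * (T0\<^sup>2 - S0 \<bullet> S0)
        + (exp (- s) * y + exp (- t) * x) * (T0 - S0 \<bullet> \<xi>) + x * y * (1 - \<xi> \<bullet> \<xi>)"
      unfolding T_def S_def x_def[symmetric] y_def[symmetric]
      by (simp add: inner_add_left inner_add_right inner_commute power2_eq_square algebra_simps)
    also have "\<dots> = exp (- s) * exp (- t) + (exp (- s) * (y * c) + exp (- t) * (x * c))"
      using T0(2) n\<xi> by (simp add: c_def algebra_simps)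
    also have "\<dots> = exp (- s) * exp (- t) + (exp (- s) * sinh t + exp (- t) * sinh s)"
      by (simp only: xy)
    also have "\<dots> = (exp (- s) * exp t + exp (- t) * exp s) / 2"
      by (simp add: sinh_def field_simps)
    also have "\<dots> = cosh (s - t)" by (simp add: cosh_def exp_diff exp_minus field_simps)
    finally show ?thesis .
  qed
  have norm: "(T t)\<^sup>2 = 1 + (norm (S t))\<^sup>2" for t
    using form[of t t] unfolding dot_square_norm by (simp flip: power2_eq_square)
  have "hgeodesic_on {0..} \<gamma>"
    unfolding hgeodesic_on_def
  proof (intro conjI ballI)
    show "\<gamma> ` {0..} \<subseteq> hyp"
      using hyperboloid_to_ball(1) Tpos norm unfolding \<gamma>_def by blast
    fix s t :: real assume "s \<in> {0..}" "t \<in> {0..}"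
    then have "hdist (\<gamma> s) (\<gamma> t) = arcosh (cosh (s - t))"
      unfolding \<gamma>_def by (subst hyperboloid_to_ball(2)[OF Tpos norm Tpos norm]) (auto simp: form)
    also have "cosh (s - t) = cosh \<bar>s - t\<bar>" by (simp only: cosh_real_abs)
    finally show "hdist (\<gamma> s) (\<gamma> t) = \<bar>s - t\<bar>" by (simp only: arcosh_cosh_real abs_ge_zero)
  qed
  moreover have "\<gamma> 0 = x0"
  proof -
    have "1 + T0 = 2 / g" using g by (simp add: T0_def divide_simps) (simp add: g_def)
    then show ?thesis using g by (simp add: \<gamma>_def S_def T_def S0_def)
  qed
  moreover have "(\<gamma> \<longlongrightarrow> \<xi>) at_top"
  proof -
    have e: "((\<lambda>t::real. exp (- t)) \<longlongrightarrow> 0) at_top" 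
      using exp_at_bot filterlim_uminus_at_bot_at_top by (rule filterlim_compose)
    have e2: "((\<lambda>t::real. exp (- t) * exp (- t)) \<longlongrightarrow> 0) at_top" 
      using tendsto_mult[OF e e] by simp
    have sh: "exp (- t) * sinh t = (1 - exp (- t) * exp (- t)) / 2" for t :: real
    proof -
      have "exp (- t) * exp t = 1" by (simp flip: exp_add)
      then show ?thesis by (simp add: sinh_def algebra_simps)
    qed
    \<comment> \<open>Numerator and denominator are multiplied by exp(-t), after which both have
      finite limits, \<xi> / (2 c) and 1 / (2 c).\<close>
    have "((\<lambda>t. ((exp (- t) * exp (- t)) *\<^sub>R S0 + ((1 - exp (- t) * exp (- t)) / 2 / c) *\<^sub>R \<xi>)
        /\<^sub>R (exp (- t) + (exp (- t) * exp (- t) * T0 + (1 - exp (- t) * exp (- t)) / 2 / c)))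
        \<longlongrightarrow> (0 *\<^sub>R S0 + ((1 - 0) / 2 / c) *\<^sub>R \<xi>) /\<^sub>R (0 + (0 * T0 + (1 - 0) / 2 / c))) at_top"
      using c by (intro tendsto_intros e e2) auto
    moreover have "\<gamma> = (\<lambda>t. ((exp (- t) * exp (- t)) *\<^sub>R S0 + ((1 - exp (- t) * exp (- t)) / 2 / c) *\<^sub>R \<xi>)
        /\<^sub>R (exp (- t) + (exp (- t) * exp (- t) * T0 + (1 - exp (- t) * exp (- t)) / 2 / c)))"
    proof (rule ext)
      fix t
      have "\<gamma> t = (exp (- t) *\<^sub>R S t) /\<^sub>R (exp (- t) * (1 + T t))" by (simp add: \<gamma>_def)
      also have "exp (- t) *\<^sub>R S t = (exp (- t) * exp (- t)) *\<^sub>R S0 + ((1 - exp (- t) * exp (- t)) / 2 / c) *\<^sub>R \<xi>"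
        by (simp add: S_def scaleR_add_right flip: sh)
      also have "exp (- t) * (1 + T t) = exp (- t) + (exp (- t) * exp (- t) * T0 + (1 - exp (- t) * exp (- t)) / 2 / c)"
        by (simp add: T_def algebra_simps flip: sh)
      finally show "\<gamma> t = ((exp (- t) * exp (- t)) *\<^sub>R S0 + ((1 - exp (- t) * exp (- t)) / 2 / c) *\<^sub>R \<xi>)
        /\<^sub>R (exp (- t) + (exp (- t) * exp (- t) * T0 + (1 - exp (- t) * exp (- t)) / 2 / c))" .
    qed
    ultimately show ?thesis using c by simp
  qed
  ultimately show thesis using that unfolding hray_def by blast
qed


section \<open>Local quasi-geodesics and Property (A)\<close>

text \<open>The metric conditions of Property (A) without their distinguished end points, so that
  lists can be translated, shortened and glued.\<close>

definition chain :: "real \<Rightarrow> 'a::euclidean_space list \<Rightarrow> bool" where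
  "chain L ws \<longleftrightarrow> set ws \<subseteq> hyp \<and>
     (\<forall>i. i + 1 < length ws \<longrightarrow> hdist (ws ! i) (ws ! (i + 1)) \<ge> L) \<and>
     (\<forall>i. i + 2 < length ws \<longrightarrow>
        gromov_prod (ws ! (i + 1)) (ws ! i) (ws ! (i + 2)) \<le> L / 10 ^ 6)"

text \<open>The two lists overlap in the whole edge from p to q, so any three consecutive points lie
  together in one of them.\<close>

lemma chain_glue:
  assumes 1: "chain L (xs @ [p, q])" and 2: "chain L (p # q # ys)"
  shows "chain L (xs @ p # q # ys)"
proof -
  define ws where "ws = xs @ p # q # ys"
  define n where "n = length xs"
  have nth1: "(xs @ [p, q]) ! i = ws ! i" if "i < n + 2" for i
  proof -
    have "ws = (xs @ [p, q]) @ ys" by (simp add: ws_def)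
    then show ?thesis using that nth_append_left[of i "xs @ [p, q]" ys] by (simp add: n_def)
  qed
  have nth2: "(p # q # ys) ! (i - n) = ws ! i" if "n \<le> i" for i
    using that by (simp add: ws_def nth_append n_def)
  have len: "length ws = n + 2 + length ys" by (simp add: ws_def n_def)
  have "L \<le> hdist (ws ! i) (ws ! (i + 1))" if "i + 1 < length ws" for i
  proof (cases "i < n")
    case True
    then have "i + 1 < length (xs @ [p, q])" by (simp add: n_def)
    then show ?thesis using 1 True nth1[of i] nth1[of "i + 1"] unfolding chain_def by force
  next
    case False
    then have "i + 1 - n = (i - n) + 1" by simp
    then show ?thesis using 2 False nth2[of i] nth2[of "i + 1"] that
      unfolding chain_def len by (auto dest!: spec[of _ "i - n"])
  qed
  moreover have "gromov_prod (ws ! (i + 1)) (ws ! i) (ws ! (i + 2)) \<le> L / 10 ^ 6"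
    if "i + 2 < length ws" for i
  proof (cases "i < n")
    case True
    then have "i + 2 < length (xs @ [p, q])" by (simp add: n_def)
    then show ?thesis using 1 True nth1[of i] nth1[of "i + 1"] nth1[of "i + 2"]
      unfolding chain_def by force
  next
    case False
    then have "i + 1 - n = (i - n) + 1" "i + 2 - n = (i - n) + 2"
      and "(i - n) + 2 < length (p # q # ys)" using that len by simp_all
    then show ?thesis using 2 False nth2[of i] nth2[of "i + 1"] nth2[of "i + 2"]
      unfolding chain_def by force
  qed
  moreover have "set ws \<subseteq> hyp" using 1 2 by (auto simp: chain_def ws_def)
  ultimately show ?thesis unfolding chain_def ws_def by blast
qed

lemma chain_tl: "chain L (x # ws) \<Longrightarrow> chain L ws"
  unfolding chain_def by (auto dest: spec[of _ "Suc _"])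

lemma chain_butlast:
  assumes "chain L (ws @ [x])"
  shows "chain L ws"
  unfolding chain_def
proof (intro conjI allI impI)
  show "set ws \<subseteq> hyp" using assms by (simp add: chain_def)
  show "L \<le> hdist (ws ! i) (ws ! (i + 1))" if "i + 1 < length ws" for i
    using assms that unfolding chain_def by (auto simp: nth_append dest!: spec[of _ i])
  show "gromov_prod (ws ! (i + 1)) (ws ! i) (ws ! (i + 2)) \<le> L / 10 ^ 6" if "i + 2 < length ws" for i
    using assms that unfolding chain_def by (auto simp: nth_append dest!: spec[of _ i])
qed

lemma chain_map:
  assumes "chain L ws" "\<And>x. x \<in> hyp \<Longrightarrow> f x \<in> hyp"
    and "\<And>x y. x \<in> hyp \<Longrightarrow> y \<in> hyp \<Longrightarrow> hdist (f x) (f y) = hdist x y"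
  shows "chain L (map f ws)"
proof -
  have "gromov_prod (f z) (f x) (f y) = gromov_prod z x y" if "x \<in> hyp" "y \<in> hyp" "z \<in> hyp" for x y z
    using that assms(3) by (simp add: gromov_prod_def)
  moreover have "ws ! i \<in> hyp" if "i < length ws" for i
    using assms(1) nth_mem[OF that] by (auto simp: chain_def)
  ultimately show ?thesis
    using assms unfolding chain_def by (auto simp: image_subset_iff)
qed

lemma chain_interior:
  assumes c: "chain L (us @ [p] @ vs)" and ne: "us \<noteq> []" "vs \<noteq> []" and L: "10 \<le> L"
  shows "gromov_prod p (hd us) (last vs) \<le> L / 10 ^ 6 + 4"
proof -
  define ws where "ws = us @ [p] @ vs"
  have nth: "ws ! 0 = hd us" "ws ! length us = p" "ws ! (length ws - 1) = last vs"
    using ne by (simp_all add: ws_def nth_append hd_conv_nth last_conv_nth)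
  have "gromov_prod (ws ! length us) (ws ! 0) (ws ! (length ws - 1)) \<le> L / 10 ^ 6 + 4"
  proof (rule chain_gromov_prod)
    show "2 * (L / 10 ^ 6) + 6 < L" using L by simp
    show "ws ! i \<in> hyp" if "i \<le> length ws - 1" for i
      using that c ne nth_mem[of i ws] unfolding ws_def[symmetric] chain_def by (auto simp: ws_def)
    show "L \<le> hdist (ws ! i) (ws ! (i + 1))" if "i < length ws - 1" for i
      using that c unfolding ws_def[symmetric] chain_def by simp
    show "gromov_prod (ws ! (i + 1)) (ws ! i) (ws ! (i + 2)) \<le> L / 10 ^ 6" if "i + 2 \<le> length ws - 1" for i
    proof -
      have "i + 2 < length ws" using that by simp
      then show ?thesis using c unfolding ws_def[symmetric] chain_def by blast
    qed
  qed (use ne in \<open>simp_all add: ws_def\<close>)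
  then show ?thesis unfolding nth .
qed

context discrete_hyp_group
begin

lemma group_carrier: "group \<Gamma>"
  using action group_hom.axioms(1) unfolding group_action_def by blast

interpretation G: group \<Gamma> by (rule group_carrier)

lemma act_hyp: "g \<in> carrier \<Gamma> \<Longrightarrow> x \<in> hyp \<Longrightarrow> act g x \<in> hyp"
  using group_action.element_image[OF action] by blast

lemma act_mult: "g \<in> carrier \<Gamma> \<Longrightarrow> h \<in> carrier \<Gamma> \<Longrightarrow> x \<in> hyp \<Longrightarrow> act (g \<otimes> h) x = act g (act h x)"
  using group_action.composition_rule[OF action] by blast

lemma act_one: "x \<in> hyp \<Longrightarrow> act \<one> x = x"
  using group_action.id_eq_one[OF action] by (metis restrict_apply)

lemma act_x0_hyp: "g \<in> carrier \<Gamma> \<Longrightarrow> act g x0 \<in> hyp"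
  by (simp add: act_hyp x0_in_hyp)

lemma len_nonneg: "g \<in> carrier \<Gamma> \<Longrightarrow> 0 \<le> len g"
  by (simp add: len_def hdist_nonneg act_x0_hyp x0_in_hyp)

lemma hdist_translate:
  assumes "g \<in> carrier \<Gamma>" "h \<in> carrier \<Gamma>"
  shows "hdist (act g x0) (act (g \<otimes> h) x0) = len h"
  using assms by (simp add: act_mult isometric len_def act_x0_hyp x0_in_hyp)

lemma hdist_orbit:
  assumes "g \<in> carrier \<Gamma>" "h \<in> carrier \<Gamma>"
  shows "hdist (act g x0) (act h x0) = len (inv g \<otimes> h)"
  using hdist_translate[of g "inv g \<otimes> h"] assms by (simp add: G.m_assoc[symmetric])

lemma len_inv: "g \<in> carrier \<Gamma> \<Longrightarrow> len (inv g) = len g"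
  using hdist_translate[of g "inv g"] by (simp add: act_one x0_in_hyp len_def hdist_commute)

lemma len_mult_le:
  assumes "g \<in> carrier \<Gamma>" "h \<in> carrier \<Gamma>"
  shows "len (g \<otimes> h) \<le> len g + len h"
  using hdist_triangle[OF x0_in_hyp act_x0_hyp[OF assms(1)] act_x0_hyp[of "g \<otimes> h"]]
    hdist_translate[OF assms] assms by (simp add: len_def)

lemma finite_gball: "finite (gball r)"
proof -
  obtain \<rho> where \<rho>: "\<rho> < 1" "\<And>y. y \<in> hyp \<Longrightarrow> hdist x0 y < r \<Longrightarrow> norm y \<le> \<rho>"
    using hyp_bounded_in_cball[OF x0_in_hyp] by blast
  \<comment> \<open>Q is made large enough to contain \<open>x0\<close>; then every g in the ball
    moves a point of Q into Q, and properness applies.\<close>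
  define Q where "Q = cball (0::'a) (max \<rho> (norm x0))"
  have "compact Q" by (simp add: Q_def)
  moreover have "Q \<subseteq> hyp" using \<rho>(1) x0_in_hyp by (auto simp: Q_def hyp_iff)
  ultimately have "finite {g \<in> carrier \<Gamma>. act g ` Q \<inter> Q \<noteq> {}}" by (rule proper)
  moreover have "gball r \<subseteq> {g \<in> carrier \<Gamma>. act g ` Q \<inter> Q \<noteq> {}}"
  proof
    fix g assume g: "g \<in> gball r"
    then have gc: "g \<in> carrier \<Gamma>" and gr: "hdist x0 (act g x0) < r" by (auto simp: gball_def len_def)
    have "x0 \<in> Q" by (simp add: Q_def)
    moreover have "act g x0 \<in> Q" using \<rho>(2)[OF act_x0_hyp[OF gc] gr] by (simp add: Q_def)
    ultimately show "g \<in> {g \<in> carrier \<Gamma>. act g ` Q \<inter> Q \<noteq> {}}" using gc by auto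
  qed
  ultimately show ?thesis by (rule finite_subset[rotated])
qed

end

context hyp_group_with_map
begin

interpretation G: group \<Gamma> by (rule group_carrier)

text \<open>The exponents n = m = 0 contribute the value 0, so the supremum is nonnegative and the
  hypotheses on a and b leave 3 * 10^6. This absorbs all additive hyperbolicity constants.\<close>

lemma len_a_large: "3 * 10 ^ 6 < len a"
proof -
  have "gromov_prod x0 (act (a [^] (0::int)) x0) (act (b [^] (0::int)) x0) \<in> power_products a b"
    unfolding power_products_def by blast
  then have "0 \<in> power_products a b"
    by (simp add: act_one x0_in_hyp gromov_prod_def)
  then have "0 \<le> Sup (power_products a b)" using ab_bdd by (rule cSup_upper)
  then show ?thesis using a_large b_large by simp
qed

text \<open>Both outer edges are translates of the edge from \<open>x0\<close> to
  \<open>act a x0\<close>. Displaying them makes them available as the overlap in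
  \<open>chain_glue\<close>.\<close>

lemma property_A_iff_chain:
  "property_A a h \<longleftrightarrow> h \<in> carrier \<Gamma> \<and>
     (\<exists>ms. chain (len a) (act (inv a) x0 # x0 # ms @ [act h x0, act (h \<otimes> a) x0]))"
proof (cases "h \<in> carrier \<Gamma>")
  case True
  have ends: "act (inv a) x0 \<in> hyp" "act (h \<otimes> a) x0 \<in> hyp"
    using True a_in by (auto intro!: act_x0_hyp)
  show ?thesis
  proof
    assume "property_A a h"
    then obtain zs where zs: "length zs \<ge> 2" "set zs \<subseteq> hyp" "hd zs = x0" "last zs = act h x0"
      and c: "\<forall>i. i + 1 < length (act (inv a) x0 # zs @ [act (h \<otimes> a) x0]) \<longrightarrow>
          hdist ((act (inv a) x0 # zs @ [act (h \<otimes> a) x0]) ! i)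
            ((act (inv a) x0 # zs @ [act (h \<otimes> a) x0]) ! (i + 1)) \<ge> len a"
        "\<forall>i. i + 2 < length (act (inv a) x0 # zs @ [act (h \<otimes> a) x0]) \<longrightarrow>
          gromov_prod ((act (inv a) x0 # zs @ [act (h \<otimes> a) x0]) ! (i + 1))
            ((act (inv a) x0 # zs @ [act (h \<otimes> a) x0]) ! i)
            ((act (inv a) x0 # zs @ [act (h \<otimes> a) x0]) ! (i + 2)) \<le> len a / 10 ^ 6"
      unfolding property_A_def Let_def by blast
    from zs(1) obtain z zs' where "zs = z # zs'" "zs' \<noteq> []"
      by (cases zs) (auto simp: Suc_le_length_iff)
    then obtain ms where ms: "zs = x0 # ms @ [act h x0]"
      using zs(3,4) by (cases zs' rule: rev_cases) auto
    have "chain (len a) (act (inv a) x0 # zs @ [act (h \<otimes> a) x0])"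
      unfolding chain_def using c zs(2) ends by auto
    then show "h \<in> carrier \<Gamma> \<and>
      (\<exists>ms. chain (len a) (act (inv a) x0 # x0 # ms @ [act h x0, act (h \<otimes> a) x0]))"
      using ms True by auto
  next
    assume "h \<in> carrier \<Gamma> \<and>
      (\<exists>ms. chain (len a) (act (inv a) x0 # x0 # ms @ [act h x0, act (h \<otimes> a) x0]))"
    then obtain ms where ms: "chain (len a) (act (inv a) x0 # x0 # ms @ [act h x0, act (h \<otimes> a) x0])"
      by blast
    define zs where "zs = x0 # ms @ [act h x0]"
    have "chain (len a) (act (inv a) x0 # zs @ [act (h \<otimes> a) x0])" using ms by (simp add: zs_def)
    moreover have "length zs \<ge> 2" "hd zs = x0" "last zs = act h x0" by (simp_all add: zs_def)
    ultimately show "property_A a h"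
      unfolding property_A_def Let_def chain_def using True by (intro conjI exI[of _ zs]) auto
  qed
qed (simp add: property_A_def)

lemma property_A_carrier: "property_A a h \<Longrightarrow> h \<in> carrier \<Gamma>"
  by (simp add: property_A_def)

text \<open>Translated by g a, the first edge of the chain of h becomes the edge from
  \<open>act g x0\<close> to \<open>act (g \<otimes> a) x0\<close>, which is the last edge of the
  chain of g.\<close>

lemma property_A_mult_chain:
  assumes g: "property_A a g" and h: "property_A a h"
  obtains ms ns where
    "chain (len a) (act (inv a) x0 # x0 # ms @ act g x0 # act (g \<otimes> a) x0 # ns @
       [act (g \<otimes> a \<otimes> h) x0, act (g \<otimes> a \<otimes> h \<otimes> a) x0])"
proof -
  have gc: "g \<in> carrier \<Gamma>" and hc: "h \<in> carrier \<Gamma>"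
    using assms property_A_carrier by auto
  obtain ms where ms: "chain (len a) (act (inv a) x0 # x0 # ms @ [act g x0, act (g \<otimes> a) x0])"
    using g property_A_iff_chain by blast
  obtain ns where ns: "chain (len a) (act (inv a) x0 # x0 # ns @ [act h x0, act (h \<otimes> a) x0])"
    using h property_A_iff_chain by blast
  let ?t = "act (g \<otimes> a)"
  have "chain (len a) (map ?t (act (inv a) x0 # x0 # ns @ [act h x0, act (h \<otimes> a) x0]))"
    using ns gc a_in by (intro chain_map) (auto intro: act_hyp isometric)
  moreover have "?t (act (inv a) x0) = act g x0"
    using gc a_in by (simp add: act_mult[symmetric] x0_in_hyp G.m_assoc)
  moreover have "?t (act h x0) = act (g \<otimes> a \<otimes> h) x0" "?t (act (h \<otimes> a) x0) = act (g \<otimes> a \<otimes> h \<otimes> a) x0"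
    using gc hc a_in by (simp_all add: act_mult[symmetric] x0_in_hyp G.m_assoc)
  ultimately have "chain (len a) (act g x0 # ?t x0 # map ?t ns @
      [act (g \<otimes> a \<otimes> h) x0, act (g \<otimes> a \<otimes> h \<otimes> a) x0])" by simp
  then show thesis
    using that[of ms "map ?t ns"] ms
      chain_glue[of "len a" "act (inv a) x0 # x0 # ms" "act g x0" "?t x0"] by simp
qed

lemma property_A_mult:
  assumes "property_A a g" "property_A a h"
  shows "property_A a (g \<otimes> a \<otimes> h)"
proof -
  obtain ms ns where "chain (len a) (act (inv a) x0 # x0 # ms @ act g x0 # act (g \<otimes> a) x0 # ns @
       [act (g \<otimes> a \<otimes> h) x0, act (g \<otimes> a \<otimes> h \<otimes> a) x0])"
    using property_A_mult_chain[OF assms] .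
  then show ?thesis
    unfolding property_A_iff_chain using assms property_A_carrier a_in
    by (auto intro!: exI[of _ "ms @ act g x0 # act (g \<otimes> a) x0 # ns"])
qed

text \<open>Without its two outer points the glued chain runs from \<open>x0\<close> to the orbit
  point of the product and has \<open>act g x0\<close> in its interior. This is what puts prefixes
  close to geodesics.\<close>

lemma property_A_gromov_prod:
  assumes "property_A a g" "property_A a h"
  shows "gromov_prod (act g x0) x0 (act (g \<otimes> a \<otimes> h) x0) \<le> len a / 10 ^ 6 + 4"
proof -
  obtain ms ns where "chain (len a) (act (inv a) x0 # x0 # ms @ act g x0 # act (g \<otimes> a) x0 # ns @
       [act (g \<otimes> a \<otimes> h) x0, act (g \<otimes> a \<otimes> h \<otimes> a) x0])"
    using property_A_mult_chain[OF assms] .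
  from chain_tl[OF this] have "chain (len a) (((x0 # ms) @ [act g x0] @ (act (g \<otimes> a) x0 # ns @
       [act (g \<otimes> a \<otimes> h) x0])) @ [act (g \<otimes> a \<otimes> h \<otimes> a) x0])" by simp
  from chain_interior[OF chain_butlast[OF this]] show ?thesis using len_a_large by simp
qed

text \<open>The joining letter adds \<open>len a\<close>, and the two corners at its ends cost at
  most 4 (len a / 10^6 + 4) together, which is less.\<close>

lemma property_A_len_mult:
  assumes g: "property_A a g" and h: "property_A a h"
  shows "len g + len h \<le> len (g \<otimes> a \<otimes> h)"
proof -
  have gc: "g \<in> carrier \<Gamma>" and hc: "h \<in> carrier \<Gamma>"
    using assms property_A_carrier by auto
  obtain ns where "chain (len a) (act (inv a) x0 # x0 # ns @ [act h x0, act (h \<otimes> a) x0])"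
    using h property_A_iff_chain by blast
  then have "chain (len a) (([act (inv a) x0] @ [x0] @ (ns @ [act h x0])) @ [act (h \<otimes> a) x0])"
    by simp
  from chain_interior[OF chain_butlast[OF this]]
  have "gromov_prod x0 (act (inv a) x0) (act h x0) \<le> len a / 10 ^ 6 + 4"
    using len_a_large by simp
  moreover have "hdist (act (inv a) x0) (act h x0) = len (a \<otimes> h)"
    using hdist_orbit[of "inv a" h] a_in hc by simp
  moreover have "hdist (act (inv a) x0) x0 = len a"
    using len_inv[OF a_in] by (simp add: len_def hdist_commute)
  ultimately have ah: "len a + len h - 2 * (len a / 10 ^ 6 + 4) \<le> len (a \<otimes> h)"
    unfolding gromov_prod_def len_def[of h] by (simp add: field_simps)
  have "hdist (act g x0) (act (g \<otimes> a \<otimes> h) x0) = len (a \<otimes> h)"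
    using hdist_translate[of g "a \<otimes> h"] gc hc a_in by (simp add: G.m_assoc)
  then have "len g + len (a \<otimes> h) - len (g \<otimes> a \<otimes> h) \<le> 2 * (len a / 10 ^ 6 + 4)"
    using property_A_gromov_prod[OF g h] by (simp add: gromov_prod_def len_def)
  then show ?thesis using ah len_a_large by simp
qed

text \<open>Both prefixes are close to the geodesic from \<open>x0\<close> to the common end point,
  so their distance is the difference of their lengths up to a constant: twice 4 from the corners
  and twice 2 from hyperbolicity make 12.\<close>

lemma property_A_first_letter:
  assumes A: "property_A a g" "property_A a h" "property_A a u" "property_A a v"
    and eq: "g \<otimes> a \<otimes> u = h \<otimes> a \<otimes> v"
  shows "hdist (act g x0) (act h x0) \<le> \<bar>len g - len h\<bar> + 2 * (len a / 10 ^ 6) + 12"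
proof -
  have gc: "g \<in> carrier \<Gamma>" and hc: "h \<in> carrier \<Gamma>" and uc: "u \<in> carrier \<Gamma>"
    using assms property_A_carrier by auto
  let ?z = "act (g \<otimes> a \<otimes> u) x0"
  have z: "?z \<in> hyp" using gc uc a_in by (auto intro!: act_x0_hyp)
  have 1: "len g - (len a / 10 ^ 6 + 4) \<le> gromov_prod x0 (act g x0) ?z"
    using property_A_gromov_prod[OF A(1,3)]
    by (simp add: gromov_prod_def len_def hdist_commute field_simps)
  have 2: "len h - (len a / 10 ^ 6 + 4) \<le> gromov_prod x0 ?z (act h x0)"
    using property_A_gromov_prod[OF A(2,4)] unfolding eq
    by (simp add: gromov_prod_def len_def hdist_commute field_simps)
  have "min (gromov_prod x0 (act g x0) ?z) (gromov_prod x0 ?z (act h x0))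
      \<le> gromov_prod x0 (act g x0) (act h x0) + 2"
    by (intro gromov_prod_hyperbolic z act_x0_hyp x0_in_hyp gc hc)
  then have "min (len g) (len h) - (len a / 10 ^ 6 + 4) - 2 \<le> gromov_prod x0 (act g x0) (act h x0)"
    using 1 2 by (auto simp: min_def split: if_splits)
  then have "hdist (act g x0) (act h x0)
      \<le> len g + len h - 2 * (min (len g) (len h) - (len a / 10 ^ 6 + 4) - 2)"
    by (simp add: gromov_prod_def len_def hdist_commute[of "act g x0" x0] field_simps)
  also have "\<dots> = \<bar>len g - len h\<bar> + 2 * (len a / 10 ^ 6) + 12"
    by (auto simp: min_def abs_if field_simps)
  finally show ?thesis .
qed

end


section \<open>Words in the letters\<close>

lemma span_via_mono:
  assumes "S \<subseteq> T" "g \<in> span_via \<Gamma> a S"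
  shows "g \<in> span_via \<Gamma> a T"
  using assms(2) by induction (use assms(1) in \<open>auto intro: span_via.intros\<close>)

text \<open>Lets all estimates of the series be carried out on finite sets with real values.\<close>

lemma poincare_sum_le_iff:
  assumes "0 \<le> B"
  shows "hyp_orbit.poincare_series act x0 A s \<le> ennreal B \<longleftrightarrow>
    (\<forall>G. finite G \<longrightarrow> G \<subseteq> A \<longrightarrow> (\<Sum>g\<in>G. exp (- s * hyp_orbit.len act x0 g)) \<le> B)"
  unfolding hyp_orbit.poincare_series_def nonneg_infsum_complete[OF zero_le]
  using assms by (auto simp: SUP_le_iff sum_ennreal ennreal_le_iff)

context tower_construction
begin

interpretation G: group \<Gamma> by (rule group_carrier)

lemma letter_stage:
  assumes "g \<in> K \<union> \<phi> ` {1..}"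
  obtains k where "1 \<le> k" "g \<in> K \<union> \<phi> ` {1..<k}"
proof (cases "g \<in> K")
  case True
  then show ?thesis using that[of 1] by simp
next
  case False
  then obtain i where "1 \<le> i" "g = \<phi> i" using assms by auto
  then show ?thesis using that[of "Suc i"] by simp
qed

text \<open>A word uses finitely many letters and the alphabets increase with the stage, so some
  stage contains all of them.\<close>

lemma F_union_eq: "F_union = span_via \<Gamma> a (K \<union> \<phi> ` {1..})"
proof (intro equalityI subsetI)
  fix g assume "g \<in> F_union"
  then show "g \<in> span_via \<Gamma> a (K \<union> \<phi> ` {1..})"
    unfolding F_union_def F_step_def by (auto intro: span_via_mono[rotated])
next
  fix g assume "g \<in> span_via \<Gamma> a (K \<union> \<phi> ` {1..})"
  then show "g \<in> F_union"
  proof induction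
    case (single g)
    then obtain k where "1 \<le> k" "g \<in> K \<union> \<phi> ` {1..<k}" by (rule letter_stage)
    then show ?case unfolding F_union_def F_step_def by (auto intro: span_via.single)
  next
    case (snoc w g)
    obtain j where j: "1 \<le> j" "g \<in> K \<union> \<phi> ` {1..<j}" using snoc(2) by (rule letter_stage)
    obtain k where k: "1 \<le> k" "w \<in> span_via \<Gamma> a (K \<union> \<phi> ` {1..<k})"
      using snoc.IH unfolding F_union_def F_step_def by auto
    have "w \<in> span_via \<Gamma> a (K \<union> \<phi> ` {1..<max k j})"
      by (rule span_via_mono[OF _ k(2)]) auto
    moreover have "g \<in> K \<union> \<phi> ` {1..<max k j}" using j by auto
    ultimately have "w \<otimes> a \<otimes> g \<in> F_step (max k j)"
      unfolding F_step_def by (rule span_via.snoc)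
    then show ?case using k unfolding F_union_def by (auto intro!: bexI[of _ "max k j"])
  qed
qed

lemma exc_carrier: "1 \<le> k \<Longrightarrow> exc k \<in> carrier \<Gamma>"
  using exc[of k] by (auto simp: excursions_def)

lemma enum_carrier: "1 \<le> k \<Longrightarrow> enum k \<in> carrier \<Gamma>"
  using enum by auto

lemma letter_property_A:
  assumes "g \<in> K \<union> \<phi> ` {1..}"
  shows "property_A a g"
  using assms K_subset
  by (auto simp: \<phi>_def intro!: property_A_mult \<Phi>_property_A exc_carrier enum_carrier)

lemma F_property_A: "g \<in> F_union \<Longrightarrow> property_A a g"
  unfolding F_union_eq
  by (induction rule: span_via.induct) (blast intro: property_A_mult letter_property_A)+

lemma F_carrier: "g \<in> F_union \<Longrightarrow> g \<in> carrier \<Gamma>"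
  using F_property_A property_A_carrier by blast

lemma letter_in_F: "g \<in> K \<union> \<phi> ` {1..} \<Longrightarrow> g \<in> F_union"
  unfolding F_union_eq by (rule span_via.single)

text \<open>\<open>span_via\<close> appends one letter at a time on the right; induction on v with
  associativity appends a whole word.\<close>

lemma F_mult:
  assumes u: "u \<in> F_union" and v: "v \<in> F_union"
  shows "u \<otimes> a \<otimes> v \<in> F_union"
  using v unfolding F_union_eq
proof induction
  case (single g)
  then show ?case using u unfolding F_union_eq by (rule span_via.snoc[rotated])
next
  case (snoc w g)
  have "w \<in> carrier \<Gamma>" "g \<in> carrier \<Gamma>"
    using snoc(1,2) F_carrier letter_in_F unfolding F_union_eq by blast+
  then have "u \<otimes> a \<otimes> (w \<otimes> a \<otimes> g) = (u \<otimes> a \<otimes> w) \<otimes> a \<otimes> g"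
    using F_carrier[OF u] a_in by (simp add: G.m_assoc)
  then show ?case using span_via.snoc[OF snoc.IH snoc(2)] by simp
qed

lemma F_len_mult: "u \<in> F_union \<Longrightarrow> v \<in> F_union \<Longrightarrow> len u + len v \<le> len (u \<otimes> a \<otimes> v)"
  by (intro property_A_len_mult F_property_A)

section \<open>Sizes of the constants, growth of the letters, and branching of
  \<open>K\<close>\<close>

lemma growth_pos: "0 < crit_exp (carrier \<Gamma>)"
proof (rule ccontr)
  assume "\<not> 0 < crit_exp (carrier \<Gamma>)"
  then have neg: "crit_exp (carrier \<Gamma>) \<le> 0" by simp
  define r where "r = max r0 (len a) + 1"
  have l1: "len \<one> = 0" by (simp add: len_def act_one x0_in_hyp)
  have "r0 \<le> r" "len a < r" "0 < r" using len_a_large by (auto simp: r_def)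
  \<comment> \<open>The unit and a already give two elements, whereas a nonpositive exponent would
    let the growth bound allow only one.\<close>
  then have "{\<one>, a} \<subseteq> gball r" using l1 a_in by (auto simp: gball_def)
  moreover have "\<one> \<noteq> a" using l1 len_a_large by auto
  ultimately have "2 \<le> card (gball r)"
    using card_mono[OF finite_gball, of "{\<one>, a}" r] by simp
  moreover have "real (card (gball r)) \<le> exp ((1 + 0.001 * \<epsilon>) * crit_exp (carrier \<Gamma>) * r)"
    using \<open>r0 \<le> r\<close> by (rule r0)
  moreover have "exp ((1 + 0.001 * \<epsilon>) * crit_exp (carrier \<Gamma>) * r) \<le> 1"
  proof -
    have "(1 + 0.001 * \<epsilon>) * crit_exp (carrier \<Gamma>) \<le> 0"
      using neg \<epsilon>_bounds by (intro mult_nonneg_nonpos) auto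
    then show ?thesis using \<open>0 < r\<close> by (simp add: mult_nonpos_nonneg)
  qed
  ultimately show False by linarith
qed

text \<open>\<open>R0_large\<close> is multiplied out and 1 + d is bounded below once by d and once
  by 1, where d is the critical exponent of the group.\<close>

lemma scales:
  shows "3000 < C" "10 ^ 7 * (C + r0) < \<epsilon> * R 0" "10 ^ 7 * C < \<epsilon> * (crit_exp (carrier \<Gamma>) * R 0)"
    "1 \<le> R 0"
proof -
  let ?d = "crit_exp (carrier \<Gamma>)"
  show C: "3000 < C" using C_def len_a_large by simp
  have "10 ^ 7 * (C + r0) * (1 + ?d) < R 0 * (?d * \<epsilon>)"
    using R0_large growth_pos \<epsilon>_bounds by (simp add: pos_divide_less_eq)
  moreover have "10 ^ 7 * (C + r0) * ?d \<le> 10 ^ 7 * (C + r0) * (1 + ?d)"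
    "10 ^ 7 * (C + r0) * 1 \<le> 10 ^ 7 * (C + r0) * (1 + ?d)"
    using C r0_nonneg growth_pos by (intro mult_left_mono; simp)+
  ultimately have 1: "10 ^ 7 * (C + r0) * ?d < (\<epsilon> * R 0) * ?d"
    and 2: "10 ^ 7 * (C + r0) < \<epsilon> * (?d * R 0)"
    by (simp_all add: mult_ac)
  show A: "10 ^ 7 * (C + r0) < \<epsilon> * R 0" using 1 growth_pos mult_less_cancel_right_pos by blast
  show "10 ^ 7 * C < \<epsilon> * (?d * R 0)" using 2 r0_nonneg by simp
  have "1 < \<epsilon> * R 0" using A C r0_nonneg by simp
  then have "0 < R 0" using \<epsilon>_bounds by (metis not_less_iff_gr_or_eq order_less_trans zero_less_mult_pos zero_less_one)
  then have "\<epsilon> * R 0 \<le> 1 * R 0" using \<epsilon>_bounds by (intro mult_right_mono) auto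
  then show "1 \<le> R 0" using \<open>1 < \<epsilon> * R 0\<close> by simp
qed

lemma R_ge: "real k + 1 \<le> R k"
proof (induction k)
  case 0
  then show ?case using scales by simp
next
  case (Suc k)
  then show ?case using R_growth[of "Suc k"] by simp
qed

text \<open>On long elements \<Phi> multiplies by b at most once on each side, and each factor
  shortens by at most \<open>len b\<close>.\<close>

lemma len_\<Phi>_ge:
  assumes g: "g \<in> carrier \<Gamma>" and long: "len a \<le> len g"
  shows "len g - 2 * len b \<le> len (\<Phi> g)"
proof -
  note bnn = len_nonneg[OF b_in]
  have l: "len h - len b \<le> len (b \<otimes> h)" if "h \<in> carrier \<Gamma>" for h
    using len_mult_le[of "inv b" "b \<otimes> h"] len_inv[OF b_in] that b_in
    by (simp add: G.m_assoc[symmetric])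
  have r: "len h - len b \<le> len (h \<otimes> b)" if "h \<in> carrier \<Gamma>" for h
    using len_mult_le[of "h \<otimes> b" "inv b"] len_inv[OF b_in] that b_in
    by (simp add: G.m_assoc)
  show ?thesis
  proof (cases "property_A a g")
    case True
    then show ?thesis using \<Phi>_id bnn by simp
  next
    case False
    then show ?thesis
      using \<Phi>_long[OF g False long] l[OF g] r[OF g] r[of "b \<otimes> g"] g b_in bnn by auto
  qed
qed

text \<open>The margin 2500 C = 2.5 \<open>len a\<close> in the choice of \<open>exc k\<close>
  absorbs the loss 2 \<open>len b\<close>, and R grows at least linearly. Linear growth suffices to
  dominate sums over k by a geometric series.\<close>

lemma len_\<phi>_ge:
  assumes "1 \<le> k"
  shows "real k \<le> len (\<phi> k)"
proof -
  have e: "R k + 2500 * C \<le> len (exc k)"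
    using exc[OF assms] exc_carrier[OF assms] by (auto simp: gball_def)
  have A: "property_A a (\<Phi> (exc k))" "property_A a (\<Phi> (enum k))"
    using assms exc_carrier enum_carrier \<Phi>_property_A by auto
  have "len a \<le> len (exc k)" using e C_def scales(1) R_ge[of k] by simp
  then have "len (exc k) - 2 * len b \<le> len (\<Phi> (exc k))"
    by (rule len_\<Phi>_ge[OF exc_carrier[OF assms]])
  moreover have "len (\<Phi> (exc k)) \<le> len (\<phi> k)"
    unfolding \<phi>_def using property_A_len_mult[OF A] len_nonneg[OF property_A_carrier[OF A(2)]] by simp
  ultimately show ?thesis using e C_def scales(1) R_ge[of k] a_large by simp
qed

text \<open>If K had at most one element, maximality would confine the shell E to a small ball
  around it. E and the inner ball would then hold at most 2 exp((1 - 0.002 \<epsilon>) X) elements,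
  fewer than \<open>R0_count\<close> provides.\<close>

lemma K_two_elements: "\<exists>g\<in>K. \<exists>h\<in>K. g \<noteq> h"
proof (rule ccontr)
  assume single: "\<not> ?thesis"
  let ?d = "crit_exp (carrier \<Gamma>)"
  define X where "X = ?d * R 0"
  define E where "E = (gball (R 0) \<inter> \<Phi> ` carrier \<Gamma>) - gball ((1 - 0.003 * \<epsilon>) * R 0)"
  have \<epsilon>X: "10 ^ 7 * C < \<epsilon> * X" using scales(3) by (simp add: X_def)
  have X: "0 < X" using growth_pos scales(4) by (simp add: X_def)
  have near: "hdist (act g x0) (act x x0) \<le> 0.004 * \<epsilon> * R 0" if g: "g \<in> K" and x: "x \<in> E" for g x
  proof (rule ccontr)
    assume far: "\<not> ?thesis"
    have K: "K = {g}" using g single by auto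
    have "insert x K = K"
      using g x K_subset far by (intro K_maximal) (auto simp: K E_def hdist_commute)
    then show False using far K \<epsilon>_bounds scales(4) by auto
  qed
  \<comment> \<open>Left translation by the inverse of the only element of K carries E into a ball
    at the base point. The radius is 0.005 rather than 0.004 because \<open>gball\<close> is
    open.\<close>
  have cardE: "card E \<le> card (gball (0.005 * \<epsilon> * R 0))"
  proof (cases "K = {}")
    case True
    have "E = {}"
    proof (rule ccontr)
      assume "E \<noteq> {}"
      then obtain x where "x \<in> E" by auto
      then have "{x} = K" by (intro K_maximal) (auto simp: True E_def)
      then show False using True by simp
    qed
    then show ?thesis by simp
  next
    case False
    then obtain g where g: "g \<in> K" by auto
    then have gc: "g \<in> carrier \<Gamma>" using K_subset by (auto simp: gball_def)
    have "inj_on (\<lambda>x. inv g \<otimes> x) E" using gc by (auto simp: inj_on_def E_def gball_def)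
    moreover have "(\<lambda>x. inv g \<otimes> x) ` E \<subseteq> gball (0.005 * \<epsilon> * R 0)"
    proof
      fix y assume "y \<in> (\<lambda>x. inv g \<otimes> x) ` E"
      then obtain x where x: "x \<in> E" "y = inv g \<otimes> x" by auto
      then have xc: "x \<in> carrier \<Gamma>" by (auto simp: E_def gball_def)
      have "len y \<le> 0.004 * \<epsilon> * R 0" using near[OF g x(1)] hdist_orbit[OF gc xc] x by simp
      also have "\<dots> < 0.005 * \<epsilon> * R 0" using \<epsilon>_bounds scales(4) by simp
      finally show "y \<in> gball (0.005 * \<epsilon> * R 0)" using x gc xc by (simp add: gball_def)
    qed
    ultimately show ?thesis by (rule card_inj_on_le) (rule finite_gball)
  qed
  have r1: "r0 \<le> 0.005 * \<epsilon> * R 0" using scales r0_nonneg by simp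
  have r2: "r0 \<le> (1 - 0.003 * \<epsilon>) * R 0"
  proof -
    have "\<epsilon> * R 0 \<le> 1 * R 0" using \<epsilon>_bounds scales(4) by (intro mult_right_mono) auto
    moreover have "r0 \<le> 5 / 1000 * (\<epsilon> * R 0)" using r1 by simp
    ultimately have "r0 \<le> R 0 - 3 / 1000 * (\<epsilon> * R 0)" using scales(4) by linarith
    then show ?thesis by (simp add: left_diff_distrib)
  qed
  have "exp ((1 - 0.001 * \<epsilon>) * X) \<le> real (card (gball (R 0) \<inter> \<Phi> ` carrier \<Gamma>))"
    using R0_count by (simp add: X_def mult.assoc)
  also have "\<dots> \<le> real (card (E \<union> gball ((1 - 0.003 * \<epsilon>) * R 0)))"
    by (intro of_nat_mono card_mono) (auto simp: E_def finite_gball)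
  also have "\<dots> \<le> real (card E) + real (card (gball ((1 - 0.003 * \<epsilon>) * R 0)))"
    using card_Un_le[of E] by (simp flip: of_nat_add)
  also have "\<dots> \<le> real (card (gball (0.005 * \<epsilon> * R 0))) + real (card (gball ((1 - 0.003 * \<epsilon>) * R 0)))"
    using cardE by simp
  also have "\<dots> \<le> exp ((1 + 0.001 * \<epsilon>) * ?d * (0.005 * \<epsilon> * R 0))
      + exp ((1 + 0.001 * \<epsilon>) * ?d * ((1 - 0.003 * \<epsilon>) * R 0))"
    by (intro add_mono r0 r1 r2)
  \<comment> \<open>(1 + 0.001 \<epsilon>)(1 - 0.003 \<epsilon>) <= 1 - 0.002 \<epsilon> treats the
    inner ball; the exponent of the small ball is below 0.006 X.\<close>
  also have "\<dots> \<le> exp ((1 - 0.002 * \<epsilon>) * X) + exp ((1 - 0.002 * \<epsilon>) * X)"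
  proof (intro add_mono)
    have "(1 + 0.001 * \<epsilon>) * (0.005 * \<epsilon>) \<le> 1.001 * 0.005"
      using \<epsilon>_bounds by (intro mult_mono) auto
    also have "1.001 * 0.005 \<le> 1 - 0.002 * \<epsilon>" using \<epsilon>_bounds by simp
    finally have "(1 + 0.001 * \<epsilon>) * (0.005 * \<epsilon>) \<le> 1 - 0.002 * \<epsilon>" .
    then have "(1 + 0.001 * \<epsilon>) * (0.005 * \<epsilon>) * X \<le> (1 - 0.002 * \<epsilon>) * X"
      using X by (intro mult_right_mono) auto
    then show "exp ((1 + 0.001 * \<epsilon>) * ?d * (0.005 * \<epsilon> * R 0)) \<le> exp ((1 - 0.002 * \<epsilon>) * X)"
      by (simp add: X_def mult_ac)
    have "(1 + 0.001 * \<epsilon>) * (1 - 0.003 * \<epsilon>) \<le> 1 - 0.002 * \<epsilon>"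
      by (simp add: algebra_simps)
    then have "(1 + 0.001 * \<epsilon>) * (1 - 0.003 * \<epsilon>) * X \<le> (1 - 0.002 * \<epsilon>) * X"
      using X by (intro mult_right_mono) auto
    then show "exp ((1 + 0.001 * \<epsilon>) * ?d * ((1 - 0.003 * \<epsilon>) * R 0)) \<le> exp ((1 - 0.002 * \<epsilon>) * X)"
      by (simp add: X_def mult_ac)
  qed
  finally have "exp ((1 - 0.001 * \<epsilon>) * X) \<le> 2 * exp ((1 - 0.002 * \<epsilon>) * X)" by simp
  also have "(1 - 0.001 * \<epsilon>) * X = 0.001 * (\<epsilon> * X) + (1 - 0.002 * \<epsilon>) * X" by (simp add: algebra_simps)
  finally have "exp (0.001 * (\<epsilon> * X)) \<le> 2" by (simp add: exp_add)
  moreover have "2 < 0.001 * (\<epsilon> * X)" using \<epsilon>X scales(1) by simp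
  ultimately show False using exp_ge_add_one_self[of "0.001 * (\<epsilon> * X)"] by linarith
qed

text \<open>Lengths in K differ by at most 0.003 \<epsilon> R_0, so by
  \<open>property_A_first_letter\<close> two possible first letters are closer than the separation
  0.004 \<epsilon> R_0.\<close>

lemma K_first_letter:
  assumes g: "g \<in> K" and h: "h \<in> K" and u: "u \<in> F_union" and v: "v \<in> F_union"
    and eq: "g \<otimes> a \<otimes> u = h \<otimes> a \<otimes> v"
  shows "g = h"
proof (rule ccontr)
  assume "g \<noteq> h"
  then have far: "0.004 * \<epsilon> * R 0 < hdist (act g x0) (act h x0)" using K_separated g h by simp
  have range: "(1 - 0.003 * \<epsilon>) * R 0 \<le> len k \<and> len k < R 0" if "k \<in> K" for k
    using that K_subset by (auto simp: gball_def)
  have "\<bar>len g - len h\<bar> \<le> 0.003 * \<epsilon> * R 0"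
    using range[OF g] range[OF h] unfolding left_diff_distrib by linarith
  moreover have "hdist (act g x0) (act h x0) \<le> \<bar>len g - len h\<bar> + 2 * (len a / 10 ^ 6) + 12"
    using g h u v eq by (intro property_A_first_letter F_property_A letter_property_A) auto
  moreover have "2 * (len a / 10 ^ 6) + 12 < 0.001 * (\<epsilon> * R 0)"
    using scales r0_nonneg C_def by simp
  ultimately show False using far by simp
qed

end


section \<open>The Poincare series of F\<close>

context tower_construction
begin

interpretation G: group \<Gamma> by (rule group_carrier)

abbreviation \<delta> :: real where
  "\<delta> \<equiv> crit_exp F_union"

abbreviation P_F :: "real \<Rightarrow> real" where
  "P_F s \<equiv> enn2real (poincare_series F_union s)"

text \<open>Enlarging the radius to at least \<open>r0\<close> brings every ball into the range of
  the growth hypothesis, at the price of a constant factor.\<close>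

lemma card_gball_le:
  "real (card (gball r)) \<le> exp ((1 + 0.001 * \<epsilon>) * crit_exp (carrier \<Gamma>) * (r0 + max 0 r))"
proof -
  have "real (card (gball r)) \<le> real (card (gball (r0 + max 0 r)))"
    using r0_nonneg by (intro of_nat_mono card_mono finite_gball) (auto simp: gball_def)
  also have "\<dots> \<le> exp ((1 + 0.001 * \<epsilon>) * crit_exp (carrier \<Gamma>) * (r0 + max 0 r))"
    by (rule r0) simp
  finally show ?thesis .
qed

text \<open>The annulus n <= len g < n + 1 has at most exp(h (r0 + n + 1)) elements, so at exponent
  h + 1 the annuli form a geometric series of ratio exp(-1).\<close>

lemma poincare_series_finite_at:
  "\<exists>s. poincare_series F_union s < \<infinity>"
proof -
  define h where "h = (1 + 0.001 * \<epsilon>) * crit_exp (carrier \<Gamma>)"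
  have h: "0 < h" using growth_pos \<epsilon>_bounds by (simp add: h_def)
  define B where "B = exp (h * (r0 + 1)) * (1 / (1 - exp (- 1)))"
  have e1: "exp (- 1 :: real) < 1" by simp
  have "(\<Sum>g\<in>Y. exp (- (h + 1) * len g)) \<le> B" if Y: "finite Y" "Y \<subseteq> F_union" for Y
  proof -
    define f where "f g = nat \<lfloor>len g\<rfloor>" for g
    have f: "real (f g) \<le> len g \<and> len g < real (f g) + 1" if "g \<in> Y" for g
      using len_nonneg[OF F_carrier, of g] that Y unfolding f_def by (auto; linarith)
    have fin: "finite (f ` Y)" using Y by simp
    have "(\<Sum>g\<in>Y. exp (- (h + 1) * len g)) = (\<Sum>n\<in>f ` Y. \<Sum>g\<in>{g \<in> Y. f g = n}. exp (- (h + 1) * len g))"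
      by (rule sum.group[symmetric]) (use Y in auto)
    also have "\<dots> \<le> (\<Sum>n\<in>f ` Y. exp (h * (r0 + 1)) * exp (- 1) ^ n)"
    proof (rule sum_mono)
      fix n
      have sub: "{g \<in> Y. f g = n} \<subseteq> gball (real n + 1)"
        using f Y F_carrier by (auto simp: gball_def)
      have "(\<Sum>g\<in>{g \<in> Y. f g = n}. exp (- (h + 1) * len g))
          \<le> (\<Sum>g\<in>{g \<in> Y. f g = n}. exp (- (h + 1) * real n))"
        using f h by (intro sum_mono) auto
      also have "\<dots> = real (card {g \<in> Y. f g = n}) * exp (- (h + 1) * real n)" by simp
      also have "\<dots> \<le> exp (h * (r0 + (real n + 1))) * exp (- (h + 1) * real n)"
      proof (rule mult_right_mono)
        have "real (card {g \<in> Y. f g = n}) \<le> real (card (gball (real n + 1)))"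
          by (intro of_nat_mono card_mono finite_gball sub)
        also have "\<dots> \<le> exp (h * (r0 + (real n + 1)))"
          using card_gball_le[of "real n + 1"] by (simp add: h_def)
        finally show "real (card {g \<in> Y. f g = n}) \<le> exp (h * (r0 + (real n + 1)))" .
      qed simp
      also have "\<dots> = exp (h * (r0 + 1)) * exp (- real n)"
        by (simp add: algebra_simps flip: exp_add)
      also have "exp (- real n) = exp (- 1) ^ n" using exp_of_nat_mult[of n "-1::real"] by simp
      finally show "(\<Sum>g\<in>{g \<in> Y. f g = n}. exp (- (h + 1) * len g))
          \<le> exp (h * (r0 + 1)) * exp (- 1) ^ n" .
    qed
    also have "\<dots> = exp (h * (r0 + 1)) * (\<Sum>n\<in>f ` Y. exp (- 1) ^ n)" by (simp add: sum_distrib_left)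
    also have "\<dots> \<le> B"
      unfolding B_def using sum_le_suminf[of "\<lambda>n. exp (- 1 :: real) ^ n", OF _ fin]
      by (intro mult_left_mono) (auto simp: summable_geometric suminf_geometric)
    finally show ?thesis .
  qed
  moreover have "0 \<le> B" by (simp add: B_def)
  ultimately have "poincare_series F_union (h + 1) \<le> ennreal B"
    by (subst poincare_sum_le_iff) auto
  then show ?thesis by (metis ennreal_less_top infinity_ennreal_def order_le_less_trans)
qed

lemma poincare_series_antimono:
  assumes "s \<le> t"
  shows "poincare_series F_union t \<le> poincare_series F_union s"
  unfolding poincare_series_def
  by (intro infsum_mono nonneg_summable_on_complete ennreal_leI)
    (use assms len_nonneg F_carrier in \<open>auto intro: mult_right_mono\<close>)

lemma P_F_finite_sum:
  assumes "poincare_series F_union s < \<infinity>" "finite Y" "Y \<subseteq> F_union"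
  shows "(\<Sum>g\<in>Y. exp (- s * len g)) \<le> P_F s"
proof -
  have "poincare_series F_union s \<le> ennreal (P_F s)" using assms(1) by simp
  then show ?thesis using assms(2,3) by (subst (asm) poincare_sum_le_iff) auto
qed

text \<open>Two letters of \<open>K\<close> begin distinct elements \<open>g a u\<close>, so that
  \<open>2 exp (- s B) P(s) \<le> P(s)\<close> with \<open>B = R 0 + len a\<close> wherever the series converges.\<close>

lemma poincare_series_doubling:
  assumes fin: "poincare_series F_union s < \<infinity>" and s: "0 \<le> s"
  shows "2 * exp (- (s * (R 0 + len a))) \<le> 1"
proof -
  obtain g h where gh: "g \<in> K" "h \<in> K" "g \<noteq> h" using K_two_elements by blast
  define B where "B = R 0 + len a"
  have gF: "g \<in> F_union" "h \<in> F_union" using gh by (auto intro: letter_in_F)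
  have pos: "0 < P_F s"
  proof -
    have "exp (- s * len g) \<le> P_F s" using P_F_finite_sum[OF fin, of "{g}"] gF by simp
    then show ?thesis using exp_gt_zero[of "- s * len g"] by linarith
  qed
  have up: "exp (- (s * B)) * exp (- s * len u) \<le> exp (- s * len (k \<otimes> a \<otimes> u))"
    if k: "k \<in> K" and u: "u \<in> F_union" for k u
  proof -
    have c: "k \<in> carrier \<Gamma>" "u \<in> carrier \<Gamma>" using k u F_carrier letter_in_F by auto
    have "len k < R 0" using k K_subset by (auto simp: gball_def)
    then have "len (k \<otimes> a \<otimes> u) \<le> B + len u"
      using len_mult_le[of "k \<otimes> a" u] len_mult_le[of k a] c a_in by (simp add: B_def)
    then have "s * len (k \<otimes> a \<otimes> u) \<le> s * (B + len u)" using s by (rule mult_left_mono)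
    then show ?thesis by (simp add: algebra_simps flip: exp_add)
  qed
  have "(\<Sum>u\<in>Y. exp (- s * len u)) \<le> P_F s / (2 * exp (- (s * B)))"
    if Y: "finite Y" "Y \<subseteq> F_union" for Y
  proof -
    let ?m = "\<lambda>k u. k \<otimes> a \<otimes> u"
    have inj: "inj_on (?m k) Y" if "k \<in> F_union" for k
    proof (rule inj_onI)
      fix x y assume xy: "x \<in> Y" "y \<in> Y" "k \<otimes> a \<otimes> x = k \<otimes> a \<otimes> y"
      have "x \<in> carrier \<Gamma>" "y \<in> carrier \<Gamma>" "k \<otimes> a \<in> carrier \<Gamma>"
        using xy Y that a_in F_carrier by auto
      then show "x = y" using xy(3) by simp
    qed
    have disj: "?m g ` Y \<inter> ?m h ` Y = {}"
      using K_first_letter[OF gh(1,2)] gh(3) Y by blast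
    have half: "exp (- (s * B)) * (\<Sum>u\<in>Y. exp (- s * len u)) \<le> (\<Sum>x\<in>?m k ` Y. exp (- s * len x))"
      if "k \<in> K" for k
    proof -
      have "exp (- (s * B)) * (\<Sum>u\<in>Y. exp (- s * len u)) = (\<Sum>u\<in>Y. exp (- (s * B)) * exp (- s * len u))"
        by (simp add: sum_distrib_left)
      also have "\<dots> \<le> (\<Sum>u\<in>Y. exp (- s * len (?m k u)))"
        using up[OF that] Y by (intro sum_mono) auto
      also have "\<dots> = (\<Sum>x\<in>?m k ` Y. exp (- s * len x))"
        using inj[of k] that letter_in_F by (subst sum.reindex) auto
      finally show ?thesis .
    qed
    have "2 * exp (- (s * B)) * (\<Sum>u\<in>Y. exp (- s * len u))
        \<le> (\<Sum>x\<in>?m g ` Y. exp (- s * len x)) + (\<Sum>x\<in>?m h ` Y. exp (- s * len x))"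
      using half[OF gh(1)] half[OF gh(2)] by simp
    also have "\<dots> = (\<Sum>x\<in>?m g ` Y \<union> ?m h ` Y. exp (- s * len x))"
      using Y disj by (intro sum.union_disjoint[symmetric]) auto
    also have "\<dots> \<le> P_F s"
      using Y gF by (intro P_F_finite_sum[OF fin]) (auto intro: F_mult)
    finally show ?thesis by (simp add: field_simps)
  qed
  then have "poincare_series F_union s \<le> ennreal (P_F s / (2 * exp (- (s * B))))"
    using pos by (subst poincare_sum_le_iff) auto
  then have "P_F s \<le> P_F s / (2 * exp (- (s * B)))"
    using pos by (simp add: enn2real_leI)
  then show ?thesis using pos by (simp add: B_def field_simps)
qed

text \<open>Convergence at a negative s would imply convergence at 0, where the doubling inequality
  reads 2 <= 1. For s >= 0 the bound is the logarithm of that inequality.\<close>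

lemma poincare_series_finite_imp:
  assumes fin: "poincare_series F_union s < \<infinity>"
  shows "ln 2 / (R 0 + len a) \<le> s"
proof -
  have B: "0 < R 0 + len a" using scales(4) len_a_large by simp
  have s: "0 \<le> s"
  proof (rule ccontr)
    assume "\<not> 0 \<le> s"
    then have "poincare_series F_union 0 \<le> poincare_series F_union s"
      by (intro poincare_series_antimono) simp
    then have "poincare_series F_union 0 < \<infinity>" using fin by (rule order_le_less_trans)
    from poincare_series_doubling[OF this] show False by simp
  qed
  have "2 \<le> exp (s * (R 0 + len a))"
    using poincare_series_doubling[OF fin s] unfolding exp_minus by (simp add: pos_divide_le_eq flip: divide_inverse)
  then have "ln 2 \<le> ln (exp (s * (R 0 + len a)))" by (intro ln_mono) auto
  then have "ln 2 \<le> s * (R 0 + len a)" by (simp only: ln_exp)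
  then show ?thesis using B by (simp add: pos_divide_le_eq)
qed

text \<open>The lower bound for exponents of convergence passes to their infimum, as there is at
  least one such exponent.\<close>

lemma crit_exp_pos: "0 < \<delta>"
proof -
  have "ln 2 / (R 0 + len a) \<le> \<delta>"
    unfolding crit_exp_def
    by (rule cInf_greatest) (use poincare_series_finite_at poincare_series_finite_imp in auto)
  moreover have "0 < ln 2 / (R 0 + len a)" using scales(4) len_a_large by simp
  ultimately show ?thesis by linarith
qed

lemma poincare_series_finite:
  assumes "\<delta> < s"
  shows "poincare_series F_union s < \<infinity>"
proof -
  have "bdd_below {s. poincare_series F_union s < \<infinity>}"
    using poincare_series_finite_imp by (intro bdd_belowI) auto
  then obtain t where "poincare_series F_union t < \<infinity>" "t < s"
    using assms poincare_series_finite_at unfolding crit_exp_def by (subst (asm) cInf_less_iff) auto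
  then show ?thesis using poincare_series_antimono[of t s] by (metis less_imp_le order_le_less_trans)
qed

lemma P_F_pos:
  assumes "\<delta> < s"
  shows "0 < P_F s"
proof -
  obtain g where "g \<in> K" using K_two_elements by blast
  then have "exp (- s * len g) \<le> P_F s"
    using P_F_finite_sum[OF poincare_series_finite[OF assms], of "{g}"] letter_in_F by simp
  then show ?thesis using exp_gt_zero[of "- s * len g"] by linarith
qed

lemma P_F_antimono:
  assumes "\<delta> < s" "s \<le> t"
  shows "P_F t \<le> P_F s"
  using poincare_series_antimono[OF assms(2)] poincare_series_finite[OF assms(1)]
  by (intro enn2real_mono) auto

section \<open>Elements containing a long letter and their weight\<close>

text \<open>Optional prefixes and suffixes of a word around a letter; \<open>None\<close> stands for the empty one.\<close>

definition prefix_elt :: "'g option \<Rightarrow> 'g" where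
  "prefix_elt p = (case p of None \<Rightarrow> \<one> | Some u \<Rightarrow> u \<otimes> a)"

definition suffix_elt :: "'g option \<Rightarrow> 'g" where
  "suffix_elt q = (case q of None \<Rightarrow> \<one> | Some v \<Rightarrow> a \<otimes> v)"

definition opt_len :: "'g option \<Rightarrow> real" where
  "opt_len p = (case p of None \<Rightarrow> 0 | Some u \<Rightarrow> len u)"

definition opt_F :: "'g option set" where
  "opt_F = insert None (Some ` F_union)"

text \<open>One decomposition of this kind suffices for membership. The prefix \<open>None\<close>
  has length 0, so every word that starts with some \<open>\<phi> k\<close>, k >= N, belongs to the
  set.\<close>

definition long_letter :: "real \<Rightarrow> nat \<Rightarrow> 'g set" where
  "long_letter c N = {prefix_elt p \<otimes> \<phi> k \<otimes> suffix_elt q | p k q.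
     p \<in> opt_F \<and> q \<in> opt_F \<and> N \<le> k \<and> 1 \<le> k \<and> c * opt_len p \<le> len (\<phi> k)}"

lemma \<phi>_in_F: "1 \<le> k \<Longrightarrow> \<phi> k \<in> F_union"
  by (auto intro: letter_in_F)

lemma prefix_suffix_closed:
  assumes "p \<in> opt_F" "q \<in> opt_F" "w \<in> F_union"
  shows "prefix_elt p \<otimes> w \<otimes> suffix_elt q \<in> F_union"
    and "opt_len p + len w + opt_len q \<le> len (prefix_elt p \<otimes> w \<otimes> suffix_elt q)"
proof -
  have pre: "prefix_elt p \<otimes> w \<in> F_union \<and> opt_len p + len w \<le> len (prefix_elt p \<otimes> w)"
    using assms F_mult F_len_mult F_carrier
    by (auto simp: opt_F_def prefix_elt_def opt_len_def)
  define x where "x = prefix_elt p \<otimes> w"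
  have "x \<otimes> suffix_elt q \<in> F_union \<and> len x + opt_len q \<le> len (x \<otimes> suffix_elt q)"
  proof (cases q)
    case None
    then show ?thesis using pre F_carrier by (auto simp: suffix_elt_def opt_len_def x_def[symmetric])
  next
    case (Some v)
    then have v: "v \<in> F_union" using assms(2) by (auto simp: opt_F_def)
    have "x \<otimes> (a \<otimes> v) = x \<otimes> a \<otimes> v"
      using pre v F_carrier a_in by (simp add: G.m_assoc x_def[symmetric])
    then show ?thesis
      using pre v F_mult F_len_mult by (simp add: Some suffix_elt_def opt_len_def x_def[symmetric])
  qed
  then show "prefix_elt p \<otimes> w \<otimes> suffix_elt q \<in> F_union"
    "opt_len p + len w + opt_len q \<le> len (prefix_elt p \<otimes> w \<otimes> suffix_elt q)"
    using pre by (auto simp: x_def)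
qed

text \<open>The appended word is absorbed by the suffix. Hence the complement inside F is stable
  under removing final letters, which the induction in \<open>prefix_of_length\<close> relies
  on.\<close>

lemma long_letter_mult:
  assumes w: "w \<in> long_letter c N" and x: "x \<in> F_union"
  shows "w \<otimes> a \<otimes> x \<in> long_letter c N"
proof -
  obtain p k q where w: "w = prefix_elt p \<otimes> \<phi> k \<otimes> suffix_elt q"
    and 1: "p \<in> opt_F" "q \<in> opt_F" "N \<le> k" "1 \<le> k" "c * opt_len p \<le> len (\<phi> k)"
    using w unfolding long_letter_def by blast
  define y where "y = prefix_elt p \<otimes> \<phi> k"
  have "prefix_elt p \<otimes> \<phi> k \<otimes> suffix_elt None \<in> F_union"
    using 1 by (intro prefix_suffix_closed(1) \<phi>_in_F) (auto simp: opt_F_def)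
  moreover have c: "prefix_elt p \<in> carrier \<Gamma>" "\<phi> k \<in> carrier \<Gamma>"
    using 1 \<phi>_in_F F_carrier a_in by (auto simp: prefix_elt_def opt_F_def)
  ultimately have y: "y \<in> carrier \<Gamma>" by (simp add: y_def)
  have "\<exists>q'\<in>opt_F. suffix_elt q \<otimes> a \<otimes> x = suffix_elt q'"
  proof (cases q)
    case None
    then show ?thesis using x a_in by (intro bexI[of _ "Some x"]) (auto simp: suffix_elt_def opt_F_def)
  next
    case (Some v)
    then have v: "v \<in> F_union" using 1 by (auto simp: opt_F_def)
    then show ?thesis using x a_in F_carrier F_mult[OF v x]
      by (intro bexI[of _ "Some (v \<otimes> a \<otimes> x)"]) (auto simp: Some suffix_elt_def opt_F_def G.m_assoc)
  qed
  then obtain q' where q': "q' \<in> opt_F" "suffix_elt q \<otimes> a \<otimes> x = suffix_elt q'" by blast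
  have "suffix_elt q \<in> carrier \<Gamma>" using 1 a_in F_carrier by (auto simp: suffix_elt_def opt_F_def)
  then have "w \<otimes> a \<otimes> x = prefix_elt p \<otimes> \<phi> k \<otimes> suffix_elt q'"
    using y x a_in F_carrier unfolding w q'(2)[symmetric] y_def[symmetric] by (simp add: G.m_assoc)
  then show ?thesis unfolding long_letter_def using 1 q'(1) by blast
qed

lemma opt_finite_sum:
  assumes "\<delta> < s" "finite Y" "Y \<subseteq> opt_F"
  shows "(\<Sum>p\<in>Y. exp (- s * opt_len p)) \<le> 1 + P_F s"
proof -
  define Z where "Z = {u. Some u \<in> Y}"
  have "finite (Some ` Z)" by (rule finite_subset[OF _ assms(2)]) (auto simp: Z_def)
  then have Z: "finite Z" by (simp add: finite_image_iff)
  have "Y \<subseteq> insert None (Some ` Z)"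
  proof
    fix p assume "p \<in> Y"
    then show "p \<in> insert None (Some ` Z)" by (cases p) (auto simp: Z_def)
  qed
  then have "(\<Sum>p\<in>Y. exp (- s * opt_len p)) \<le> (\<Sum>p\<in>insert None (Some ` Z). exp (- s * opt_len p))"
    using Z by (intro sum_mono2) auto
  also have "\<dots> = 1 + (\<Sum>u\<in>Z. exp (- s * len u))"
    using Z by (subst sum.insert) (auto simp: opt_len_def sum.reindex)
  also have "(\<Sum>u\<in>Z. exp (- s * len u)) \<le> P_F s"
    using assms(3) by (intro P_F_finite_sum[OF poincare_series_finite[OF assms(1)] Z])
      (auto simp: Z_def opt_F_def)
  finally show ?thesis by simp
qed

text \<open>With \<open>\<eta> = c \<delta> / 2\<close>, a prefix \<open>u\<close> with \<open>c len u \<le> len (\<phi> k)\<close> satisfies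
  \<open>exp (- s len u) \<le> exp (- (\<delta> + \<eta>) len u) exp (\<delta> len (\<phi> k) / 2)\<close>: the sum over prefixes is
  bounded uniformly in \<open>s\<close> at the cost of half of the exponent of \<open>\<phi> k\<close>.\<close>

lemma long_letter_sum:
  assumes c: "0 < c" and s: "\<delta> < s" "s \<le> \<delta> + c * \<delta> / 2"
    and Y: "finite Y" "Y \<subseteq> long_letter c N"
  shows "(\<Sum>g\<in>Y. exp (- s * len g))
    \<le> exp (- \<delta> / 2) ^ N / (1 - exp (- \<delta> / 2)) * (1 + P_F (\<delta> + c * \<delta> / 2)) * (1 + P_F s)"
proof -
  define \<eta> where "\<eta> = c * \<delta> / 2"
  have d: "0 < \<delta>" by (rule crit_exp_pos)
  have \<eta>: "0 < \<eta>" using d c by (simp add: \<eta>_def)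
  define r where "r = exp (- \<delta> / 2)"
  have r: "0 < r" "r < 1" using d by (auto simp: r_def)
  \<comment> \<open>One decomposition is chosen for each g. It determines g, so \<open>dec\<close>
    is injective and the sum over Y becomes a sum over triples.\<close>
  have "\<forall>g\<in>Y. \<exists>t. fst t \<in> opt_F \<and> snd (snd t) \<in> opt_F \<and> N \<le> fst (snd t) \<and> 1 \<le> fst (snd t) \<and>
      c * opt_len (fst t) \<le> len (\<phi> (fst (snd t))) \<and>
      g = prefix_elt (fst t) \<otimes> \<phi> (fst (snd t)) \<otimes> suffix_elt (snd (snd t))"
    using Y unfolding long_letter_def by fastforce
  then obtain dec where dec: "\<And>g. g \<in> Y \<Longrightarrow> fst (dec g) \<in> opt_F \<and> snd (snd (dec g)) \<in> opt_F \<and>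
      N \<le> fst (snd (dec g)) \<and> 1 \<le> fst (snd (dec g)) \<and>
      c * opt_len (fst (dec g)) \<le> len (\<phi> (fst (snd (dec g)))) \<and>
      g = prefix_elt (fst (dec g)) \<otimes> \<phi> (fst (snd (dec g))) \<otimes> suffix_elt (snd (snd (dec g)))"
    by metis
  have inj: "inj_on dec Y" by (rule inj_onI) (metis dec)
  \<comment> \<open>Replacing the set of triples by the product of its three projections only adds
    positive terms and makes the sum factor.\<close>
  define A B D where "A = (fst \<circ> dec) ` Y" and "B = (fst \<circ> snd \<circ> dec) ` Y"
    and "D = (snd \<circ> snd \<circ> dec) ` Y"
  let ?f = "\<lambda>p. exp (- (\<delta> + \<eta>) * opt_len p)" and ?h = "\<lambda>q. exp (- s * opt_len q)"
  have term_le: "exp (- s * len g) \<le> ?f (fst (dec g)) * (r ^ fst (snd (dec g)) * ?h (snd (snd (dec g))))"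
    if g: "g \<in> Y" for g
  proof -
    obtain p k q where t: "dec g = (p, k, q)" by (cases "dec g") auto
    have 1: "p \<in> opt_F" "q \<in> opt_F" "1 \<le> k" "c * opt_len p \<le> len (\<phi> k)"
      "g = prefix_elt p \<otimes> \<phi> k \<otimes> suffix_elt q" using dec[OF g] t by auto
    have pos: "0 \<le> opt_len p" using 1(1) len_nonneg F_carrier by (auto simp: opt_len_def opt_F_def)
    have lk: "real k \<le> len (\<phi> k)" by (rule len_\<phi>_ge[OF 1(3)])
    have "opt_len p + len (\<phi> k) + opt_len q \<le> len g"
      unfolding 1(5) by (rule prefix_suffix_closed(2)[OF 1(1,2) \<phi>_in_F[OF 1(3)]])
    then have "s * (opt_len p + len (\<phi> k) + opt_len q) \<le> s * len g"
      using s(1) d by (intro mult_left_mono) auto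
    moreover have "\<eta> * opt_len p \<le> \<delta> / 2 * len (\<phi> k)"
      using mult_left_mono[OF 1(4), of "\<delta> / 2"] d by (simp add: \<eta>_def mult_ac)
    moreover have "(\<delta> + \<eta>) * opt_len p - \<eta> * opt_len p \<le> s * opt_len p"
      using mult_right_mono[OF less_imp_le[OF s(1)] pos] by (simp add: algebra_simps)
    moreover have "\<delta> * len (\<phi> k) \<le> s * len (\<phi> k)"
      using s(1) lk by (intro mult_right_mono) auto
    moreover have "\<delta> / 2 * real k \<le> \<delta> / 2 * len (\<phi> k)"
      using d lk by (intro mult_left_mono) auto
    ultimately have "- s * len g \<le> - (\<delta> + \<eta>) * opt_len p + (real k * (- \<delta> / 2) + - s * opt_len q)"
      by (simp add: algebra_simps)
    then have "exp (- s * len g) \<le> exp (- (\<delta> + \<eta>) * opt_len p + (real k * (- \<delta> / 2) + - s * opt_len q))"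
      by (simp only: exp_le_cancel_iff)
    also have "\<dots> = ?f p * (r ^ k * ?h q)"
      by (simp only: exp_add exp_of_nat_mult r_def)
    finally show ?thesis by (simp add: t)
  qed
  have fin: "finite A" "finite B" "finite D" using Y by (auto simp: A_def B_def D_def)
  have "(\<Sum>g\<in>Y. exp (- s * len g)) \<le> (\<Sum>g\<in>Y. (\<lambda>(p, k, q). ?f p * (r ^ k * ?h q)) (dec g))"
    by (rule sum_mono) (use term_le in \<open>simp add: case_prod_beta\<close>)
  also have "\<dots> = (\<Sum>(p, k, q)\<in>dec ` Y. ?f p * (r ^ k * ?h q))"
    by (simp add: sum.reindex[OF inj] comp_def)
  also have "\<dots> \<le> (\<Sum>(p, k, q)\<in>A \<times> B \<times> D. ?f p * (r ^ k * ?h q))"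
  proof (rule sum_mono2)
    show "dec ` Y \<subseteq> A \<times> B \<times> D"
      unfolding A_def B_def D_def by (intro image_subsetI) (simp add: mem_Times_iff)
  qed (use fin r in auto)
  also have "\<dots> = (\<Sum>p\<in>A. ?f p) * (\<Sum>(k, q)\<in>B \<times> D. r ^ k * ?h q)"
    unfolding sum_product sum.cartesian_product by (simp only: split_def)
  also have "(\<Sum>(k, q)\<in>B \<times> D. r ^ k * ?h q) = (\<Sum>k\<in>B. r ^ k) * (\<Sum>q\<in>D. ?h q)"
    unfolding sum_product sum.cartesian_product ..
  also have "(\<Sum>p\<in>A. ?f p) * ((\<Sum>k\<in>B. r ^ k) * (\<Sum>q\<in>D. ?h q))
      \<le> (1 + P_F (\<delta> + \<eta>)) * (r ^ N / (1 - r) * (1 + P_F s))"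
  proof (intro mult_mono)
    show "(\<Sum>p\<in>A. ?f p) \<le> 1 + P_F (\<delta> + \<eta>)"
      using \<eta> fin dec by (intro opt_finite_sum) (auto simp: A_def)
    show "(\<Sum>q\<in>D. ?h q) \<le> 1 + P_F s"
      using s fin dec by (intro opt_finite_sum) (auto simp: D_def)
    \<comment> \<open>Every index is at least N; shifting by N extracts the factor r^N.\<close>
    have "(\<Sum>k\<in>B. r ^ k) = (\<Sum>k\<in>(\<lambda>k. k - N) ` B. r ^ (k + N))"
    proof (rule sum.reindex_bij_witness[of _ "\<lambda>k. k + N" "\<lambda>k. k - N"])
      fix k assume "k \<in> B"
      then have "N \<le> k" using dec by (auto simp: B_def)
      then show "k - N + N = k" "r ^ (k - N + N) = r ^ k" by auto
    qed (use dec in \<open>auto simp: B_def\<close>)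
    also have "\<dots> = r ^ N * (\<Sum>k\<in>(\<lambda>k. k - N) ` B. r ^ k)"
      by (simp add: power_add sum_distrib_left mult.commute)
    also have "\<dots> \<le> r ^ N * (1 / (1 - r))"
      using r sum_le_suminf[of "\<lambda>n. r ^ n" "(\<lambda>k. k - N) ` B"] fin
      by (intro mult_left_mono) (auto simp: summable_geometric suminf_geometric)
    finally show "(\<Sum>k\<in>B. r ^ k) \<le> r ^ N / (1 - r)" by simp
  qed (use r in \<open>auto intro!: sum_nonneg mult_nonneg_nonneg\<close>)
  finally show ?thesis by (simp add: r_def \<eta>_def mult_ac)
qed

end


section \<open>Rays to limits of words without long letters\<close>

context discrete_hyp_group
begin

lemma hset_dist_orbit_le:
  assumes "x \<in> hyp" "u \<in> carrier \<Gamma>"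
  shows "hset_dist {x} (orbit_of (carrier \<Gamma>)) \<le> hdist x (act u x0)"
proof -
  have "bdd_below ((\<lambda>p. hdist (fst p) (snd p)) ` ({x} \<times> orbit_of (carrier \<Gamma>)))"
    using assms(1) act_x0_hyp by (intro bdd_belowI[of _ 0]) (auto simp: orbit_of_def hdist_nonneg)
  then show ?thesis
    unfolding hset_dist_def using assms(2)
    by (intro cINF_lower2[where x = "(x, act u x0)"]) (auto simp: orbit_of_def)
qed

lemma hset_dist_orbit_nonneg:
  assumes "x \<in> hyp"
  shows "0 \<le> hset_dist {x} (orbit_of (carrier \<Gamma>))"
proof -
  have "\<one> \<in> carrier \<Gamma>" using group_carrier by (rule group.is_monoid[THEN monoid.one_closed])
  then show ?thesis
    unfolding hset_dist_def using assms act_x0_hyp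
    by (intro cINF_greatest) (auto simp: orbit_of_def hdist_nonneg)
qed

end

context tower_construction
begin

interpretation G: group \<Gamma> by (rule group_carrier)

text \<open>Take the first prefix of length at least T. Its last letter is either one of the
  finitely many letters of length at most M, or some \<open>\<phi> k\<close> with k >= N, which in a
  good word is shorter than c times the preceding prefix, hence than c T. Thus D =
  \<open>len a\<close> + M works for all words at once.\<close>

lemma prefix_of_length:
  assumes c: "0 < c"
  obtains D where "\<And>g T. g \<in> F_union - long_letter c N \<Longrightarrow> 0 \<le> T \<Longrightarrow> T \<le> len g \<Longrightarrow>
      \<exists>u\<in>F_union. T \<le> len u \<and> len u \<le> (1 + c) * T + D \<and> (u = g \<or> (\<exists>v\<in>F_union. g = u \<otimes> a \<otimes> v))"
proof -
  define M where "M = R 0 + (\<Sum>k\<in>{1..<N}. len (\<phi> k))"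
  define D where "D = len a + M"
  have \<phi>nn: "0 \<le> len (\<phi> k)" if "1 \<le> k" for k
    using len_\<phi>_ge[OF that] by linarith
  have short: "len x \<le> M" if x: "x \<in> K \<union> \<phi> ` {1..<N}" for x
  proof (cases "x \<in> K")
    case True
    then have "len x < R 0" using K_subset by (auto simp: gball_def)
    moreover have "0 \<le> (\<Sum>k\<in>{1..<N}. len (\<phi> k))" using \<phi>nn by (intro sum_nonneg) auto
    ultimately show ?thesis by (simp add: M_def)
  next
    case False
    then obtain k where "k \<in> {1..<N}" "x = \<phi> k" using x by auto
    then have "len x \<le> (\<Sum>k\<in>{1..<N}. len (\<phi> k))"
      using \<phi>nn by (auto intro!: member_le_sum[where f = "\<lambda>k. len (\<phi> k)"])
    then show ?thesis using scales(4) by (simp add: M_def)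
  qed
  have ann: "0 \<le> len a" using len_a_large by simp
  have *: "\<exists>u\<in>F_union. T \<le> len u \<and> len u \<le> (1 + c) * T + D \<and> (u = g \<or> (\<exists>v\<in>F_union. g = u \<otimes> a \<otimes> v))"
    if "g \<in> F_union" "g \<notin> long_letter c N" and T: "0 \<le> T" "T \<le> len g" for g T
    using that(1) that(2-) unfolding F_union_eq
  proof induction
    case (single x)
    have "x \<in> K \<union> \<phi> ` {1..<N}"
    proof (rule ccontr)
      assume "x \<notin> K \<union> \<phi> ` {1..<N}"
      then obtain k where k: "1 \<le> k" "N \<le> k" "x = \<phi> k" using single.hyps by force
      then have "x = prefix_elt None \<otimes> \<phi> k \<otimes> suffix_elt None"
        using F_carrier[OF \<phi>_in_F] by (simp add: prefix_elt_def suffix_elt_def)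
      moreover have "c * opt_len None \<le> len (\<phi> k)" using \<phi>nn k by (simp add: opt_len_def)
      moreover have "None \<in> opt_F" by (simp add: opt_F_def)
      ultimately have "x \<in> long_letter c N" using k unfolding long_letter_def by blast
      then show False using single by simp
    qed
    moreover have "0 \<le> (1 + c) * T" using c single by simp
    ultimately show ?case using short[of x] ann single
      by (intro bexI[of _ x] span_via.single) (auto simp: D_def)
  next
    case (snoc w x)
    have wF: "w \<in> F_union" using snoc.hyps(1) unfolding F_union_eq .
    have xF: "x \<in> F_union" using snoc.hyps(2) by (rule letter_in_F)
    have c': "w \<in> carrier \<Gamma>" "x \<in> carrier \<Gamma>" using wF xF F_carrier by auto
    have wbad: "w \<notin> long_letter c N" using snoc.prems(1) long_letter_mult[OF _ xF] by blast
    show ?case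
    proof (cases "T \<le> len w")
      case True
      from snoc.IH[OF wbad snoc.prems(2) True]
      obtain u where u: "u \<in> F_union" "T \<le> len u" "len u \<le> (1 + c) * T + D"
        "w = u \<or> (\<exists>v\<in>F_union. w = u \<otimes> a \<otimes> v)" unfolding F_union_eq by auto
      have "\<exists>v\<in>F_union. w \<otimes> a \<otimes> x = u \<otimes> a \<otimes> v"
      proof (cases "w = u")
        case False
        then obtain v where v: "v \<in> F_union" "w = u \<otimes> a \<otimes> v" using u by blast
        have "w \<otimes> a \<otimes> x = u \<otimes> a \<otimes> (v \<otimes> a \<otimes> x)"
          using v u(1) c' F_carrier a_in by (simp add: G.m_assoc)
        then show ?thesis using F_mult[OF v(1) xF] by blast
      qed (use xF in blast)
      then show ?thesis using u unfolding F_union_eq by blast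
    next
      case False
      have "len x \<le> c * T + M"
      proof (cases "x \<in> K \<union> \<phi> ` {1..<N}")
        case True
        then show ?thesis using short[OF True] c snoc.prems(2)
          by (smt (verit) mult_nonneg_nonneg)
      next
        case nshort: False
        then obtain k where k: "1 \<le> k" "N \<le> k" "x = \<phi> k" using snoc.hyps by force
        have "\<not> c * opt_len (Some w) \<le> len (\<phi> k)"
        proof
          assume "c * opt_len (Some w) \<le> len (\<phi> k)"
          moreover have "w \<otimes> a \<otimes> x = prefix_elt (Some w) \<otimes> \<phi> k \<otimes> suffix_elt None"
            using c' a_in k by (simp add: prefix_elt_def suffix_elt_def)
          moreover have "Some w \<in> opt_F" "None \<in> opt_F" using wF by (auto simp: opt_F_def)
          ultimately have "w \<otimes> a \<otimes> x \<in> long_letter c N" using k unfolding long_letter_def by blast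
          then show False using snoc.prems by simp
        qed
        then have "len x < c * len w" using k by (simp add: opt_len_def)
        also have "\<dots> \<le> c * T" using False c by (intro mult_left_mono) auto
        finally show ?thesis using short scales(4) \<phi>nn
          by (simp add: M_def) (smt (verit) sum_nonneg atLeastLessThan_iff)
      qed
      moreover have "len (w \<otimes> a \<otimes> x) \<le> len w + len a + len x"
        using len_mult_le[of "w \<otimes> a" x] len_mult_le[of w a] c' a_in by simp
      ultimately have "len (w \<otimes> a \<otimes> x) \<le> (1 + c) * T + D"
        using False by (simp add: D_def algebra_simps)
      then show ?thesis using snoc.prems F_mult[OF wF xF] unfolding F_union_eq by blast
    qed
  qed
  show thesis using that[of D] * by blast
qed

text \<open>A good g close to \<xi> has a large Gromov product with a far point of the ray, and its
  prefix u lies almost on the geodesic to g. Hyperbolicity, applied at \<open>\<gamma> S\<close> and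
  at g, compares \<open>\<gamma> (len u)\<close> with u; each use loses 2, and the final distance
  doubles the total loss.\<close>

lemma ray_near_prefix:
  assumes c: "0 < c" and \<xi>: "\<xi> \<in> hyp_boundary" and ray: "hray x0 \<xi> \<gamma>"
    and cl: "\<xi> \<in> closure ((\<lambda>g. act g x0) ` (F_union - long_letter c N))"
  obtains D where "\<And>T. 0 \<le> T \<Longrightarrow> \<exists>u\<in>carrier \<Gamma>. T \<le> len u \<and> len u \<le> (1 + c) * T + D \<and>
      hdist (\<gamma> (len u)) (act u x0) \<le> 2 * (len a / 10 ^ 6 + 4) + 8"
proof -
  obtain D where D: "\<And>g T. g \<in> F_union - long_letter c N \<Longrightarrow> 0 \<le> T \<Longrightarrow> T \<le> len g \<Longrightarrow>
      \<exists>u\<in>F_union. T \<le> len u \<and> len u \<le> (1 + c) * T + D \<and> (u = g \<or> (\<exists>v\<in>F_union. g = u \<otimes> a \<otimes> v))"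
    using prefix_of_length[OF c] by blast
  define \<kappa> where "\<kappa> = len a / 10 ^ 6 + 4"
  have \<kappa>: "4 \<le> \<kappa>" using len_a_large by (simp add: \<kappa>_def)
  have \<gamma>hyp: "\<gamma> t \<in> hyp" if "0 \<le> t" for t
    using ray that by (auto simp: hray_def hgeodesic_on_def)
  have \<gamma>dist: "hdist (\<gamma> s) (\<gamma> t) = \<bar>s - t\<bar>" if "0 \<le> s" "0 \<le> t" for s t
    using ray that by (auto simp: hray_def hgeodesic_on_def)
  have \<gamma>0: "\<gamma> 0 = x0" using ray by (simp add: hray_def)
  have \<gamma>len: "hdist x0 (\<gamma> t) = t" if "0 \<le> t" for t
    using \<gamma>dist[of 0 t] that by (simp add: \<gamma>0)
  have "\<exists>u\<in>carrier \<Gamma>. T \<le> len u \<and> len u \<le> (1 + c) * T + D \<and> hdist (\<gamma> (len u)) (act u x0) \<le> 2 * \<kappa> + 8"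
    if T: "0 \<le> T" for T
  proof -
    \<comment> \<open>T' has to exceed both T, so that g is long enough, and the largest possible
      length of u, so that u is compared with the ray before time S. The sign of D is not known
      here, hence the maximum.\<close>
    define T' where "T' = max T ((1 + c) * T + D)"
    have T': "T \<le> T'" "(1 + c) * T + D \<le> T'" by (auto simp: T'_def)
    obtain \<eta> where \<eta>: "0 < \<eta>" "\<And>x y. x \<in> hyp \<Longrightarrow> y \<in> hyp \<Longrightarrow> dist x \<xi> < \<eta> \<Longrightarrow> dist y \<xi> < \<eta> \<Longrightarrow>
        T' \<le> gromov_prod x0 x y"
      using gromov_prod_at_boundary[OF x0_in_hyp \<xi>] by blast
    have "\<forall>\<^sub>F t in at_top. dist (\<gamma> t) \<xi> < \<eta>"
      using ray \<eta>(1) unfolding hray_def by (blast dest: tendstoD)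
    then have "\<forall>\<^sub>F t in at_top. dist (\<gamma> t) \<xi> < \<eta> \<and> T' \<le> t"
      using eventually_ge_at_top[of T'] by eventually_elim simp
    then obtain S where S: "dist (\<gamma> S) \<xi> < \<eta>" "T' \<le> S"
      using eventually_happens'[OF trivial_limit_at_top_linorder] by blast
    obtain g where g: "g \<in> F_union - long_letter c N" "dist (act g x0) \<xi> < \<eta>"
      using cl \<eta>(1) unfolding closure_approachable by blast
    have gc: "g \<in> carrier \<Gamma>" using g F_carrier by blast
    have S0: "0 \<le> S" using T T' S by linarith
    have far: "T' \<le> gromov_prod x0 (\<gamma> S) (act g x0)"
      using \<eta>(2) \<gamma>hyp[OF S0] act_x0_hyp[OF gc] S g by blast
    also have "\<dots> \<le> len g"
      using hdist_triangle[OF x0_in_hyp act_x0_hyp[OF gc] \<gamma>hyp[OF S0]]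
      by (simp add: gromov_prod_def len_def hdist_commute)
    finally have "T \<le> len g" using T' by linarith
    then obtain u where u: "u \<in> F_union" "T \<le> len u" "len u \<le> (1 + c) * T + D"
      "u = g \<or> (\<exists>v\<in>F_union. g = u \<otimes> a \<otimes> v)" using D[OF g(1) T] by blast
    have uc: "u \<in> carrier \<Gamma>" using u F_carrier by blast
    have "gromov_prod (act u x0) x0 (act g x0) \<le> \<kappa>"
    proof (cases "u = g")
      case True
      then show ?thesis using \<kappa> by (simp add: gromov_prod_def)
    next
      case False
      then obtain v where "v \<in> F_union" "g = u \<otimes> a \<otimes> v" using u by blast
      then show ?thesis using property_A_gromov_prod[of u v] u F_property_A by (simp add: \<kappa>_def)
    qed
    then have up: "len u - \<kappa> \<le> gromov_prod x0 (act g x0) (act u x0)"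
      by (simp add: gromov_prod_def len_def hdist_commute field_simps)
    define t where "t = len u"
    have t: "0 \<le> t" "t \<le> T'" "t \<le> S" using u T T' S by (auto simp: t_def)
    have "gromov_prod x0 (\<gamma> t) (\<gamma> S) = t"
      using \<gamma>len[of t] \<gamma>len[of S] \<gamma>dist[of t S] t S0 by (simp add: gromov_prod_def hdist_commute)
    then have "t - 2 \<le> gromov_prod x0 (\<gamma> t) (act g x0)"
      using gromov_prod_hyperbolic[OF \<gamma>hyp[OF t(1)] \<gamma>hyp[OF S0] act_x0_hyp[OF gc] x0_in_hyp]
        far t by (auto simp: min_def split: if_splits)
    then have "t - \<kappa> - 4 \<le> gromov_prod x0 (\<gamma> t) (act u x0)"
      using gromov_prod_hyperbolic[OF \<gamma>hyp[OF t(1)] act_x0_hyp[OF gc] act_x0_hyp[OF uc] x0_in_hyp]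
        up \<kappa> by (auto simp: t_def min_def split: if_splits)
    then have "hdist (\<gamma> t) (act u x0) \<le> 2 * \<kappa> + 8"
      using \<gamma>len[OF t(1)] by (simp add: gromov_prod_def t_def len_def hdist_commute field_simps)
    then show ?thesis using u uc by (auto simp: t_def)
  qed
  then show thesis using that[of D] by (simp add: \<kappa>_def)
qed

text \<open>From time T the ray is followed to time \<open>len u\<close>, at most c T + D later,
  where the orbit is within \<open>\<kappa>\<close>; c = 1 / (m + 1) is arbitrary. Since
  \<open>\<kappa>\<close> is independent of T and \<open>len u\<close> is at least T, the same
  points show that the lower limit is finite.\<close>

lemma boundary_point_sublinear:
  assumes \<xi>: "\<xi> \<in> hyp_boundary"
    and cl: "\<And>m::nat. \<exists>N. \<xi> \<in> closure ((\<lambda>g. act g x0) ` (F_union - long_letter (1 / real (Suc m)) N))"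
  shows "\<xi> \<in> sublinear_limit_set"
proof -
  obtain \<gamma> where ray: "hray x0 \<xi> \<gamma>" using hray_exists[OF x0_in_hyp \<xi>] .
  define f where "f t = hset_dist {\<gamma> t} (orbit_of (carrier \<Gamma>))" for t
  define \<kappa> where "\<kappa> = 2 * (len a / 10 ^ 6 + 4) + 8"
  have \<gamma>hyp: "\<gamma> t \<in> hyp" if "0 \<le> t" for t
    using ray that by (auto simp: hray_def hgeodesic_on_def)
  have \<gamma>dist: "hdist (\<gamma> s) (\<gamma> t) = \<bar>s - t\<bar>" if "0 \<le> s" "0 \<le> t" for s t
    using ray that by (auto simp: hray_def hgeodesic_on_def)
  have near: "\<exists>D. \<forall>T\<ge>0. \<exists>u\<in>carrier \<Gamma>. T \<le> len u \<and> len u \<le> (1 + 1 / real (Suc m)) * T + D \<and>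
      hdist (\<gamma> (len u)) (act u x0) \<le> \<kappa>" for m
  proof -
    obtain N where "\<xi> \<in> closure ((\<lambda>g. act g x0) ` (F_union - long_letter (1 / real (Suc m)) N))"
      using cl by blast
    from ray_near_prefix[OF _ \<xi> ray this] show ?thesis unfolding \<kappa>_def by force
  qed
  have "Liminf at_top (\<lambda>t. ereal (f t)) \<noteq> \<infinity>"
  proof
    assume "Liminf at_top (\<lambda>t. ereal (f t)) = \<infinity>"
    then have "\<forall>\<^sub>F t in at_top. ereal \<kappa> < ereal (f t)" by (intro less_LiminfD) simp
    then obtain T where T: "\<And>t. T \<le> t \<Longrightarrow> \<kappa> < f t" by (auto simp: eventually_at_top_linorder)
    obtain u where u: "u \<in> carrier \<Gamma>" "max 0 T \<le> len u" "hdist (\<gamma> (len u)) (act u x0) \<le> \<kappa>"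
      using near[of 0] by (metis max.cobounded1)
    have "f (len u) \<le> \<kappa>"
      using hset_dist_orbit_le[OF \<gamma>hyp u(1), of "len u"] u by (simp add: f_def)
    then show False using T[of "len u"] u by simp
  qed
  then have con: "\<xi> \<in> conical_limit_set"
    using \<xi> ray unfolding conical_limit_set_def f_def by auto
  have "((\<lambda>t. f t / t) \<longlongrightarrow> 0) at_top"
  proof (rule tendstoI)
    fix e :: real assume e: "0 < e"
    obtain m where m: "1 / real (Suc m) < e / 2" using e nat_approx_posE[of "e / 2"] by auto
    obtain D where D: "\<And>T. 0 \<le> T \<Longrightarrow> \<exists>u\<in>carrier \<Gamma>. T \<le> len u \<and>
        len u \<le> (1 + 1 / real (Suc m)) * T + D \<and> hdist (\<gamma> (len u)) (act u x0) \<le> \<kappa>"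
      using near[of m] by blast
    have bound: "f T \<le> 1 / real (Suc m) * T + (D + \<kappa>)" if T: "0 \<le> T" for T
    proof -
      obtain u where u: "u \<in> carrier \<Gamma>" "T \<le> len u" "len u \<le> (1 + 1 / real (Suc m)) * T + D"
        "hdist (\<gamma> (len u)) (act u x0) \<le> \<kappa>" using D[OF T] by blast
      have "f T \<le> hdist (\<gamma> T) (act u x0)"
        unfolding f_def by (rule hset_dist_orbit_le[OF \<gamma>hyp[OF T] u(1)])
      also have "\<dots> \<le> hdist (\<gamma> T) (\<gamma> (len u)) + hdist (\<gamma> (len u)) (act u x0)"
        using T u by (intro hdist_triangle \<gamma>hyp act_x0_hyp) auto
      also have "\<dots> \<le> (len u - T) + \<kappa>" using \<gamma>dist[of T "len u"] T u by simp
      also have "\<dots> \<le> 1 / real (Suc m) * T + (D + \<kappa>)"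
        using u(3) by (simp add: distrib_right)
      finally show ?thesis .
    qed
    \<comment> \<open>Half of e pays for the slope 1 / (m + 1), the other half for the constant D +
      \<open>\<kappa>\<close>.\<close>
    define T0 where "T0 = max 1 (2 * (\<bar>D + \<kappa>\<bar> + 1) / e)"
    have "\<forall>\<^sub>F t in at_top. T0 \<le> t" by (rule eventually_ge_at_top)
    then show "\<forall>\<^sub>F t in at_top. dist (f t / t) 0 < e"
    proof eventually_elim
      case (elim t)
      then have t: "1 \<le> t" "2 * (\<bar>D + \<kappa>\<bar> + 1) / e \<le> t" by (auto simp: T0_def)
      have "2 * (\<bar>D + \<kappa>\<bar> + 1) \<le> t * e" using t(2) e by (simp only: pos_divide_le_eq)
      then have "D + \<kappa> < e / 2 * t" using abs_ge_self[of "D + \<kappa>"] by (simp add: mult.commute)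
      moreover have "1 / real (Suc m) * t \<le> e / 2 * t" using m t by (intro mult_right_mono) auto
      ultimately have "f t < e * t" using bound[of t] t by linarith
      moreover have "0 \<le> f t" unfolding f_def using t by (intro hset_dist_orbit_nonneg \<gamma>hyp) auto
      ultimately show ?case using t by (simp add: dist_real_def pos_divide_less_eq)
    qed
  qed
  then show ?thesis unfolding sublinear_limit_set_def using con ray unfolding f_def by blast
qed

end


section \<open>The Patterson--Sullivan measure\<close>

text \<open>An enumeration exhausts A by finite sets, and monotone convergence gives the integral as
  the supremum over them.\<close>

lemma nn_integral_count_space_le_finite_sums:
  fixes f :: "'a \<Rightarrow> ennreal"
  assumes A: "countable A" and le: "\<And>Y. finite Y \<Longrightarrow> Y \<subseteq> A \<Longrightarrow> (\<Sum>y\<in>Y. f y) \<le> B"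
  shows "(\<integral>\<^sup>+ x. f x \<partial>count_space A) \<le> B"
proof (cases "A = {}")
  case True
  then show ?thesis by (simp add: nn_integral_empty)
next
  case False
  define Y where "Y n = from_nat_into A ` {..<n}" for n :: nat
  have Y: "finite (Y n)" "Y n \<subseteq> A" for n
    using from_nat_into[OF False] by (auto simp: Y_def)
  have "(\<integral>\<^sup>+ x. f x \<partial>count_space A) = (\<integral>\<^sup>+ x. (SUP n. f x * indicator (Y n) x) \<partial>count_space A)"
  proof (intro nn_integral_cong antisym)
    fix x assume "x \<in> space (count_space A)"
    then obtain m where "from_nat_into A m = x" using from_nat_into_surj[OF A] by auto
    then have "x \<in> Y (Suc m)" by (auto simp: Y_def)
    then show "f x \<le> (SUP n. f x * indicator (Y n) x)" by (intro SUP_upper2[of "Suc m"]) auto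
  qed (auto intro!: SUP_least simp: indicator_def)
  also have "\<dots> = (SUP n. \<integral>\<^sup>+ x. f x * indicator (Y n) x \<partial>count_space A)"
  proof (rule nn_integral_monotone_convergence_SUP)
    show "incseq (\<lambda>n x. f x * indicator (Y n) x)"
      by (auto simp: incseq_def le_fun_def Y_def indicator_def)
  qed simp
  also have "\<dots> \<le> B"
  proof (rule SUP_least)
    fix n
    have "(\<integral>\<^sup>+ x. f x * indicator (Y n) x \<partial>count_space A) = (\<Sum>x\<in>Y n. f x * indicator (Y n) x)"
      using Y by (intro nn_integral_count_space') auto
    also have "\<dots> = (\<Sum>x\<in>Y n. f x)" by (intro sum.cong) auto
    finally show "(\<integral>\<^sup>+ x. f x * indicator (Y n) x \<partial>count_space A) \<le> B" using le[OF Y] by simp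
  qed
  finally show ?thesis .
qed

context tower_construction
begin

lemma countable_F: "countable F_union"
proof (rule countable_subset)
  show "F_union \<subseteq> enum ` {1..}" using F_carrier enum by blast
qed simp

text \<open>Pulled back along the orbit map, the integral is a weighted sum over F. Terms outside A
  vanish, and terms in A are at most the weight because h <= 1.\<close>

lemma ps_approx_integral_le:
  assumes s: "\<delta> < s" and B: "0 \<le> B"
    and sum: "\<And>Y. finite Y \<Longrightarrow> Y \<subseteq> A \<Longrightarrow> (\<Sum>g\<in>Y. exp (- s * len g)) \<le> B"
    and cont: "continuous_on compactified_orbit h"
    and h: "\<And>x. x \<in> compactified_orbit \<Longrightarrow> 0 \<le> h x \<and> h x \<le> 1"
    and zero: "\<And>g. g \<in> F_union - A \<Longrightarrow> h (act g x0) = 0"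
  shows "(\<integral>x. h x \<partial>ps_approx F_union s) \<le> B / P_F s"
proof -
  note pos = P_F_pos[OF s]
  have P: "poincare_series F_union s = ennreal (P_F s)"
    using poincare_series_finite[OF s] by simp
  let ?p = "\<lambda>g. ennreal (exp (- s * len g)) / poincare_series F_union s"
  have X: "act g x0 \<in> compactified_orbit" if "g \<in> F_union" for g
    using F_carrier[OF that] by (auto simp: compactified_orbit_def orbit_of_def)
  have meas [measurable]: "h \<in> borel_measurable (restrict_space borel compactified_orbit)"
    using cont by (rule borel_measurable_continuous_on_restrict)
  have meas2: "(\<lambda>g. act g x0) \<in> point_measure F_union ?p \<rightarrow>\<^sub>M restrict_space borel compactified_orbit"
    using X by (auto simp: space_restrict_space)
  have "(\<integral>\<^sup>+ x. ennreal (h x) \<partial>ps_approx F_union s)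
      = (\<integral>\<^sup>+ g. ennreal (h (act g x0)) \<partial>point_measure F_union ?p)"
    unfolding ps_approx_def by (intro nn_integral_distr meas2) measurable
  also have "\<dots> = (\<integral>\<^sup>+ g. ?p g * ennreal (h (act g x0)) \<partial>count_space F_union)"
    unfolding point_measure_def by (subst nn_integral_density) auto
  also have "\<dots> \<le> ennreal (B / P_F s)"
  proof (rule nn_integral_count_space_le_finite_sums[OF countable_F])
    fix Y assume Y: "finite Y" "Y \<subseteq> F_union"
    have "(\<Sum>g\<in>Y. ?p g * ennreal (h (act g x0))) \<le> (\<Sum>g\<in>Y. if g \<in> A then ennreal (exp (- s * len g) / P_F s) else 0)"
    proof (rule sum_mono)
      fix g assume g: "g \<in> Y"
      have "?p g = ennreal (exp (- s * len g) / P_F s)"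
        using pos by (subst P) (simp add: divide_ennreal)
      moreover have "ennreal (h (act g x0)) \<le> 1" using h[OF X] g Y by auto
      ultimately show "?p g * ennreal (h (act g x0)) \<le> (if g \<in> A then ennreal (exp (- s * len g) / P_F s) else 0)"
        using zero[of g] g Y mult_left_mono[of "ennreal (h (act g x0))" 1 "?p g"] by auto
    qed
    also have "\<dots> = (\<Sum>g\<in>Y \<inter> A. ennreal (exp (- s * len g) / P_F s))"
      by (rule sum.inter_restrict[OF Y(1), symmetric])
    also have "\<dots> = ennreal ((\<Sum>g\<in>Y \<inter> A. exp (- s * len g)) / P_F s)"
      using pos by (subst sum_ennreal) (auto simp: sum_divide_distrib)
    also have "\<dots> \<le> ennreal (B / P_F s)"
      using pos sum[of "Y \<inter> A"] Y by (intro ennreal_leI divide_right_mono) auto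
    finally show "(\<Sum>g\<in>Y. ?p g * ennreal (h (act g x0))) \<le> ennreal (B / P_F s)" .
  qed
  finally have "(\<integral>\<^sup>+ x. ennreal (h x) \<partial>ps_approx F_union s) \<le> ennreal (B / P_F s)" .
  moreover have "(\<integral>x. h x \<partial>ps_approx F_union s) = enn2real (\<integral>\<^sup>+ x. ennreal (h x) \<partial>ps_approx F_union s)"
  proof (rule integral_eq_nn_integral)
    show "h \<in> borel_measurable (ps_approx F_union s)" unfolding ps_approx_def by simp
    show "AE x in ps_approx F_union s. 0 \<le> h x"
      using h by (intro AE_I2) (auto simp: ps_approx_def space_restrict_space)
  qed
  ultimately show ?thesis using B pos by (simp add: enn2real_leI)
qed

text \<open>Along \<open>s\<^sub>n \<rightarrow> \<delta>\<close> the factor \<open>(1 + P(s)) / P(s)\<close> stays bounded because \<open>P\<close> is decreasing.\<close>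

lemma measure_away_from_good_elements:
  assumes c: "0 < c" and ps: "patterson_sullivan F_union \<mu>"
  shows "measure \<mu> (compactified_orbit - closure ((\<lambda>g. act g x0) ` (F_union - long_letter c N)))
    \<le> (1 + P_F (\<delta> + c * \<delta> / 2)) * (1 + 1 / P_F (\<delta> + c * \<delta> / 2)) / (1 - exp (- \<delta> / 2))
      * exp (- \<delta> / 2) ^ N" (is "measure \<mu> ?V \<le> ?M * ?r ^ N")
proof -
  define E where "E = (\<lambda>g. act g x0) ` (F_union - long_letter c N)"
  define \<eta> where "\<eta> = c * \<delta> / 2"
  have \<eta>: "0 < \<eta>" using c crit_exp_pos by (simp add: \<eta>_def)
  have r: "?r < 1" using crit_exp_pos by simp
  obtain s where s: "\<And>n. \<delta> < s n" "s \<longlonglongrightarrow> \<delta>"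
    "weakly_converges_on compactified_orbit (\<lambda>n. ps_approx F_union (s n)) \<mu>"
    and sets: "sets \<mu> = sets (restrict_space borel compactified_orbit)" and prob: "prob_space \<mu>"
    using ps unfolding patterson_sullivan_def by blast
  interpret prob_space \<mu> by (rule prob)
  have space: "space \<mu> = compactified_orbit"
    using sets_eq_imp_space_eq[OF sets] by (simp add: space_restrict_space)
  \<comment> \<open>Weak convergence tests continuous functions only. These vanish on the good orbit
    points and increase to the indicator of the complement of their closure. \<open>infdist\<close>
    to the empty set is 0 by convention, hence the separate value 1.\<close>
  define h where "h j x = (if E = {} then 1 else min 1 (real j * infdist x E))" for j x
  have cont: "continuous_on compactified_orbit (h j)" for j
    unfolding h_def by (cases "E = {}") (auto intro!: continuous_intros)
  have h01: "0 \<le> h j x \<and> h j x \<le> 1" for j x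
    by (simp add: h_def infdist_nonneg)
  have hz: "h j (act g x0) = 0" if "g \<in> F_union - long_letter c N" for j g
    using that by (auto simp: h_def E_def)
  have approx: "(\<integral>x. h j x \<partial>ps_approx F_union (s n)) \<le> ?M * ?r ^ N" if n: "s n \<le> \<delta> + \<eta>" for j n
  proof -
    let ?B = "?r ^ N / (1 - ?r) * (1 + P_F (\<delta> + \<eta>)) * (1 + P_F (s n))"
    have pos: "0 < P_F (s n)" "0 < P_F (\<delta> + \<eta>)" using s(1) \<eta> by (auto intro: P_F_pos)
    have "(\<integral>x. h j x \<partial>ps_approx F_union (s n)) \<le> ?B / P_F (s n)"
    proof (rule ps_approx_integral_le[OF s(1) _ _ cont h01 hz])
      show "0 \<le> ?B" using r pos by (intro mult_nonneg_nonneg divide_nonneg_nonneg) auto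
      show "(\<Sum>g\<in>Y. exp (- s n * len g)) \<le> ?B" if "finite Y" "Y \<subseteq> long_letter c N" for Y
        using long_letter_sum[OF c s(1) _ that, of n] n unfolding \<eta>_def by simp
    qed
    also have "\<dots> = ?r ^ N / (1 - ?r) * (1 + P_F (\<delta> + \<eta>)) * (1 + 1 / P_F (s n))"
      using pos by (simp add: field_simps)
    also have "\<dots> \<le> ?r ^ N / (1 - ?r) * (1 + P_F (\<delta> + \<eta>)) * (1 + 1 / P_F (\<delta> + \<eta>))"
      using r pos P_F_antimono[OF s(1) n]
      by (intro mult_left_mono add_left_mono divide_left_mono mult_nonneg_nonneg divide_nonneg_nonneg) auto
    finally show ?thesis by (simp add: \<eta>_def mult_ac)
  qed
  have bound: "(\<integral>x. h j x \<partial>\<mu>) \<le> ?M * ?r ^ N" for j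
  proof (rule tendsto_upperbound)
    have "bounded (h j ` compactified_orbit)"
      using h01 by (intro boundedI[of _ 1]) auto
    then show "(\<lambda>n. \<integral>x. h j x \<partial>ps_approx F_union (s n)) \<longlonglongrightarrow> (\<integral>x. h j x \<partial>\<mu>)"
      using s(3) cont unfolding weakly_converges_on_def by blast
    have "\<forall>\<^sub>F n in sequentially. s n < \<delta> + \<eta>" using s(2) \<eta> by (intro order_tendstoD(2)) auto
    then show "\<forall>\<^sub>F n in sequentially. (\<integral>x. h j x \<partial>ps_approx F_union (s n)) \<le> ?M * ?r ^ N"
      by eventually_elim (rule approx, simp)
  qed simp
  have V: "?V \<in> sets \<mu>"
  proof -
    have "compactified_orbit \<inter> (- closure E) \<in> sets (restrict_space borel compactified_orbit)"
      by (auto simp: sets_restrict_space)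
    then show ?thesis unfolding sets E_def by (simp add: Diff_eq)
  qed
  have hmeas: "h j \<in> borel_measurable \<mu>" for j
    using borel_measurable_continuous_on_restrict[OF cont] measurable_cong_sets[OF sets refl] by blast
  \<comment> \<open>The bound for each j is uniform in j, so this second limit, taken after the weak
    one, preserves it.\<close>
  have "(\<lambda>j. \<integral>x. h j x \<partial>\<mu>) \<longlonglongrightarrow> (\<integral>x. indicator ?V x \<partial>\<mu>)"
  proof (rule integral_dominated_convergence[where w = "\<lambda>_. 1"])
    show "AE x in \<mu>. (\<lambda>j. h j x) \<longlonglongrightarrow> indicator ?V x"
    proof (intro AE_I2)
      fix x assume x: "x \<in> space \<mu>"
      show "(\<lambda>j. h j x) \<longlonglongrightarrow> indicator ?V x"
      proof (cases "x \<in> closure E")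
        case True
        then have ne: "E \<noteq> {}" by auto
        have "infdist x E = 0" using True in_closure_iff_infdist_zero[OF ne] by blast
        with ne show ?thesis using True by (simp add: h_def E_def)
      next
        case False
        have "\<forall>\<^sub>F j in sequentially. h j x = 1"
        proof (cases "E = {}")
          case ne: False
          then have i: "0 < infdist x E"
            using False in_closure_iff_infdist_zero[OF ne] infdist_nonneg[of x E] by fastforce
          have "\<forall>\<^sub>F j in sequentially. 1 / infdist x E \<le> real j"
            using filterlim_real_sequentially unfolding filterlim_at_top by blast
          then show ?thesis
            by eventually_elim (use i ne in \<open>simp add: h_def pos_divide_le_eq min_def\<close>)
        qed (simp add: h_def)
        moreover have "indicator ?V x = (1 :: real)" using x False space by (simp add: E_def)
        ultimately show ?thesis by (simp add: tendsto_eventually)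
      qed
    qed
  qed (use V hmeas h01 in auto)
  then have "(\<integral>x. indicator ?V x \<partial>\<mu>) \<le> ?M * ?r ^ N"
    by (rule LIMSEQ_le_const2) (use bound in auto)
  then show ?thesis using V by simp
qed

text \<open>A point failing for every N lies in all the sets \<open>V N\<close>, whose measures tend
  to 0 geometrically.\<close>

lemma AE_limit_of_good_elements:
  assumes c: "0 < c" and ps: "patterson_sullivan F_union \<mu>"
  shows "AE \<xi> in \<mu>. \<exists>N. \<xi> \<in> closure ((\<lambda>g. act g x0) ` (F_union - long_letter c N))"
proof -
  define V where "V N = compactified_orbit - closure ((\<lambda>g. act g x0) ` (F_union - long_letter c N))" for N
  have sets: "sets \<mu> = sets (restrict_space borel compactified_orbit)" and "prob_space \<mu>"
    using ps unfolding patterson_sullivan_def by blast+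
  then interpret prob_space \<mu> by blast
  have space: "space \<mu> = compactified_orbit"
    using sets_eq_imp_space_eq[OF sets] by (simp add: space_restrict_space)
  have V: "V N \<in> sets \<mu>" for N
  proof -
    have "compactified_orbit \<inter> (- closure ((\<lambda>g. act g x0) ` (F_union - long_letter c N)))
        \<in> sets (restrict_space borel compactified_orbit)"
      by (auto simp: sets_restrict_space)
    then show ?thesis unfolding sets V_def by (simp add: Diff_eq)
  qed
  define M where "M = (1 + P_F (\<delta> + c * \<delta> / 2)) * (1 + 1 / P_F (\<delta> + c * \<delta> / 2)) / (1 - exp (- \<delta> / 2))"
  have "measure \<mu> (\<Inter>N. V N) \<le> M * exp (- \<delta> / 2) ^ N" for N
  proof -
    have "measure \<mu> (\<Inter>N. V N) \<le> measure \<mu> (V N)"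
      using V by (intro finite_measure_mono) auto
    then show ?thesis
      using measure_away_from_good_elements[OF c ps, of N] unfolding V_def M_def by linarith
  qed
  moreover have "(\<lambda>N. M * exp (- \<delta> / 2) ^ N) \<longlonglongrightarrow> M * 0"
    using crit_exp_pos by (intro tendsto_mult tendsto_const LIMSEQ_realpow_zero) auto
  ultimately have "measure \<mu> (\<Inter>N. V N) \<le> 0"
    by (intro LIMSEQ_le_const) auto
  then have "(\<Inter>N. V N) \<in> null_sets \<mu>"
    using V by (intro null_setsI) (auto simp: emeasure_eq_measure measure_le_0_iff)
  then have "AE \<xi> in \<mu>. \<xi> \<notin> (\<Inter>N. V N)" by (rule AE_not_in)
  then show ?thesis
    by (rule AE_mp) (auto intro!: AE_I2 simp: V_def space)
qed

theorem patterson_sullivan_AE_sublinear: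
  assumes "patterson_sullivan F_union \<mu>"
  shows "AE \<xi> in \<mu>. \<xi> \<in> limit_set F_union \<longrightarrow> \<xi> \<in> sublinear_limit_set"
proof -
  \<comment> \<open>Only the countably many values c = 1 / (m + 1) are used, so the exceptional null
    sets can be united.\<close>
  have "AE \<xi> in \<mu>. \<forall>m. \<exists>N. \<xi> \<in> closure ((\<lambda>g. act g x0) ` (F_union - long_letter (1 / real (Suc m)) N))"
    unfolding AE_all_countable using assms by (intro allI AE_limit_of_good_elements) auto
  then show ?thesis
    by (rule AE_mp) (auto intro!: AE_I2 boundary_point_sublinear simp: limit_set_def)
qed

end

theorem mainTheorem13:
  fixes \<Gamma> :: "('g, 'm) monoid_scheme"
    and act :: "'g \<Rightarrow> 'a::euclidean_space \<Rightarrow> 'a" and x0 :: 'a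
    and enum :: "nat \<Rightarrow> 'g" and a b :: 'g and \<Phi> :: "'g \<Rightarrow> 'g"
    and K :: "'g set" and exc :: "nat \<Rightarrow> 'g" and \<beta> :: "nat \<Rightarrow> real"
    and C \<epsilon> r0 :: real and R :: "nat \<Rightarrow> real" and eps :: "nat \<Rightarrow> nat \<Rightarrow> real"
    and F :: "'g set" and \<mu> :: "'a measure"
  assumes "tower_construction \<Gamma> act x0 enum a b \<Phi> K exc \<beta> C \<epsilon> r0 R eps"
    and "F = tower_data.F_union \<Gamma> enum a \<Phi> K exc"
    and "hyp_orbit.patterson_sullivan \<Gamma> act x0 F \<mu>"
  shows "AE \<xi> in \<mu>. \<xi> \<in> hyp_orbit.limit_set act x0 F \<longrightarrow>
           \<xi> \<in> hyp_orbit.sublinear_limit_set \<Gamma> act x0"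
  using tower_construction.patterson_sullivan_AE_sublinear[OF assms(1)] assms(2,3) by blast

end
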